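(* Let $G$ be a finite group, let $D\colon G\to\mathrm{GL}(d,\mathbb{R})$ be a representation, and set \[\gamma=\sum_{\chi\in\operatorname{Irr}D}\chi(1)\chi .\] Let $\pi$ be a permutation of the set $G$. Then there is an affine symmetry of the representation polytope $P(D)$ sending $D(g)$ to $D(\pi(g))$ for all $g\in G$ if and only if \[\gamma(\pi(g)^{-1}\pi(h))=\gamma(g^{-1}h)\quad\text{for all } g,h\in G.\]
   Context: $\operatorname{Irr}D$ denotes the set of irreducible complex characters of $G$ that occur as constituents of the character of $D$. The representation polytope of $D$ is $P(D)=\operatorname{conv}\{D(g)\mid g\in G\}$, a polytope in the space of real $d\times d$-matrices. An affine symmetry of a polytope $P$ is a bijection of $P$ that is the restriction of an affine map of the ambient space. *)

theory Defs
  imports "HOL-Analysis.Analysis" "Jordan_Normal_Form.VS_Connect"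
begin

text \<open>
  The real representation \<open>D\<close> uses the matrix type \<open>real ^ 'd ^ 'd\<close>, for which the library has
  convex hulls and linear maps. Complex representations occur in all degrees at once, so they
  use the matrices with explicit carriers, with the degree \<open>n\<close> a natural number.
\<close>

definition GL_real :: "(real ^ 'd ^ 'd) monoid" where
  "GL_real = \<lparr>carrier = {A. invertible A}, monoid.mult = (**), one = Finite_Cartesian_Product.mat 1\<rparr>"

definition GL_complex :: "nat \<Rightarrow> complex mat monoid" where
  "GL_complex n = units_of (ring_mat TYPE(complex) n ())"

definition mat_trace :: "complex mat \<Rightarrow> complex" where
  "mat_trace A = (\<Sum>i<dim_row A. A $$ (i, i))"

text \<open>
  Characters are functions on the carrier of \<open>G\<close>, made extensional by restriction, so that equal
  characters are equal as HOL functions and sets of characters are not inflated by values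
  outside \<open>G\<close>.
\<close>

definition rep_character :: "('g, 'b) monoid_scheme \<Rightarrow> ('g \<Rightarrow> complex mat) \<Rightarrow> 'g \<Rightarrow> complex" where
  "rep_character G R = (\<lambda>g\<in>carrier G. mat_trace (R g))"

definition real_rep_character ::
  "('g, 'b) monoid_scheme \<Rightarrow> ('g \<Rightarrow> real ^ 'd ^ 'd) \<Rightarrow> 'g \<Rightarrow> complex" where
  "real_rep_character G D = (\<lambda>g\<in>carrier G. complex_of_real (trace (D g)))"

definition irreducible_rep :: "('g, 'b) monoid_scheme \<Rightarrow> nat \<Rightarrow> ('g \<Rightarrow> complex mat) \<Rightarrow> bool" where
  "irreducible_rep G n R \<longleftrightarrow>
     R \<in> hom G (GL_complex n) \<and> n > 0 \<and>
     (\<forall>W. submodule class_ring W (module_vec TYPE(complex) n) \<and>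
          (\<forall>g\<in>carrier G. \<forall>w\<in>W. R g *\<^sub>v w \<in> W) \<longrightarrow>
          W = {0\<^sub>v n} \<or> W = carrier_vec n)"

definition irreducible_character :: "('g, 'b) monoid_scheme \<Rightarrow> ('g \<Rightarrow> complex) \<Rightarrow> bool" where
  "irreducible_character G \<psi> \<longleftrightarrow> (\<exists>n R. irreducible_rep G n R \<and> \<psi> = rep_character G R)"

text \<open>
  A constituent of \<open>\<phi>\<close> is a summand \<open>\<psi>\<close> such that \<open>\<phi> - \<psi>\<close> is a character or zero; the zero case
  is the representation of degree \<open>n = 0\<close>.
\<close>

definition is_constituent ::
  "('g, 'b) monoid_scheme \<Rightarrow> ('g \<Rightarrow> complex) \<Rightarrow> ('g \<Rightarrow> complex) \<Rightarrow> bool" where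
  "is_constituent G \<psi> \<phi> \<longleftrightarrow>
     (\<exists>n R. R \<in> hom G (GL_complex n) \<and>
            (\<forall>g\<in>carrier G. \<phi> g = \<psi> g + rep_character G R g))"

definition Irr_of ::
  "('g, 'b) monoid_scheme \<Rightarrow> ('g \<Rightarrow> real ^ 'd ^ 'd) \<Rightarrow> ('g \<Rightarrow> complex) set" where
  "Irr_of G D =
     {\<psi>. irreducible_character G \<psi> \<and> is_constituent G \<psi> (real_rep_character G D)}"

definition gamma_char ::
  "('g, 'b) monoid_scheme \<Rightarrow> ('g \<Rightarrow> real ^ 'd ^ 'd) \<Rightarrow> 'g \<Rightarrow> complex" where
  "gamma_char G D g = (\<Sum>\<psi>\<in>Irr_of G D. \<psi> \<one>\<^bsub>G\<^esub> * \<psi> g)"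

definition rep_polytope ::
  "('g, 'b) monoid_scheme \<Rightarrow> ('g \<Rightarrow> real ^ 'd ^ 'd) \<Rightarrow> (real ^ 'd ^ 'd) set" where
  "rep_polytope G D = convex hull (D ` carrier G)"

definition affine_symmetry :: "'v::real_vector set \<Rightarrow> ('v \<Rightarrow> 'v) \<Rightarrow> bool" where
  "affine_symmetry P f \<longleftrightarrow>
     bij_betw f P P \<and> (\<exists>L b. linear L \<and> (\<forall>x\<in>P. f x = L x + b))"

end

theory Submission
  imports Defs "Jordan_Normal_Form.Spectral_Radius"
begin

text \<open>
  By Schur orthogonality the matrix \<open>E(g,h) = \<gamma>(g\<inverse>h) / |G|\<close> is a Hermitian idempotent, and by complete
  reducibility its kernel consists of the complex vectors \<open>c\<close> with \<open>\<Sum> c(g) D(g) = 0\<close>; that is, \<open>E\<close> is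
  the orthogonal projection along the linear relations between the matrices \<open>D(g)\<close>. An affine symmetry
  \<open>D(g) \<mapsto> D(\<pi>(g))\<close> exists if and only if \<open>\<pi>\<close> preserves these relations, which means that \<open>E\<close> is
  invariant under \<open>\<pi>\<close>.
\<close>

unbundle no vec_syntax

section \<open>Complex matrices\<close>

text \<open>The weights chi(1) come from the group algebra: (1/|G|) sum_g gamma(g^-1) g is the sum
  of the central idempotents belonging to the constituents of \<open>D\<close>. It acts as the
  identity on these constituents and as zero on all other irreducibles, and \<open>E\<close> is the
  matrix of multiplication by it. Two obstacles shape the proof. The constituents are complex while
  the polytope is real, so a complex relation is carried as a pair of real relations, one for the
  real and one for the imaginary parts of the coefficients. And an affine map by itself respects
  only relations whose coefficients sum to 0, so its translation part must be disposed of before all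
  relations are known to be preserved. Subspaces are handled through pairs of matrices
  \<open>B\<close>, \<open>Q\<close> with \<open>Q * B\<close> the identity, because a
  subrepresentation has to become a matrix representation of its own degree again.\<close>

lemma index_mult_mat_sum:
  assumes "A \<in> carrier_mat n k" "B \<in> carrier_mat k m" "i < n" "j < m"
  shows "(A * B) $$ (i, j) = (\<Sum>l<k. A $$ (i, l) * B $$ (l, j))"
  using assms by (auto simp: scalar_prod_def atLeast0LessThan)

text \<open>Lets an identity between products act inside a right-nested product, where associativity
  carries dimension side conditions. The next lemma does the same for matrices applied to a
  vector.\<close>

lemma mult_mult_eq:
  fixes A B X :: "complex mat"
  assumes "A * B = E" "A \<in> carrier_mat n m" "B \<in> carrier_mat m k" "X \<in> carrier_mat k l"
  shows "A * (B * X) = E * X"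
  using assms by (metis assoc_mult_mat)

lemma mult_mult_vec_eq:
  fixes A B :: "complex mat"
  assumes "A * B = E" "A \<in> carrier_mat n m" "B \<in> carrier_mat m k" "x \<in> carrier_vec k"
  shows "A *\<^sub>v (B *\<^sub>v x) = E *\<^sub>v x"
  using assms by (metis assoc_mult_mat_vec)

text \<open>An elementary matrix in the middle isolates one entry of each factor. This is how
  Schur's lemma, a statement about averaged matrices, yields orthogonality of single matrix
  coefficients.\<close>

lemma mult_elementary_mult:
  fixes A B :: "complex mat"
  assumes A: "A \<in> carrier_mat n n'" and B: "B \<in> carrier_mat m m'"
    and "i < n" "j < n'" "k < m" "l < m'"
  shows "(A * Matrix.mat n' m (\<lambda>(a, b). if a = j \<and> b = k then 1 else 0) * B) $$ (i, l) = A $$ (i, j) * B $$ (k, l)"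
    (is "(A * ?E * B) $$ _ = _")
proof -
  have E: "?E \<in> carrier_mat n' m" by simp
  have AE: "(A * ?E) $$ (i, b) = (if b = k then A $$ (i, j) else 0)" if "b < m" for b
  proof -
    have "(A * ?E) $$ (i, b) = (\<Sum>a<n'. A $$ (i, a) * (if a = j \<and> b = k then 1 else 0))"
      using index_mult_mat_sum[OF A E \<open>i < n\<close> that] that by simp
    also have "\<dots> = (\<Sum>a<n'. if a = j then (if b = k then A $$ (i, j) else 0) else 0)"
      by (rule sum.cong) auto
    finally show ?thesis using \<open>j < n'\<close> by simp
  qed
  have "(A * ?E * B) $$ (i, l) = (\<Sum>b<m. (A * ?E) $$ (i, b) * B $$ (b, l))"
    using assms by (intro index_mult_mat_sum[of _ n m B m']) auto
  also have "\<dots> = (\<Sum>b<m. if b = k then A $$ (i, j) * B $$ (k, l) else 0)"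
    by (rule sum.cong) (auto simp: AE)
  finally show ?thesis using \<open>k < m\<close> by simp
qed

lemma mat_eq_vecI:
  fixes A B :: "complex mat"
  assumes A: "A \<in> carrier_mat n m" and B: "B \<in> carrier_mat n m"
    and eq: "\<And>v. v \<in> carrier_vec m \<Longrightarrow> A *\<^sub>v v = B *\<^sub>v v"
  shows "A = B"
proof (rule eq_matI)
  fix i j assume ij: "i < dim_row B" "j < dim_col B"
  then show "A $$ (i, j) = B $$ (i, j)"
    using arg_cong[OF eq[of "unit_vec m j"], of "\<lambda>u. u $ i"] A B
    by (auto simp: mult_mat_vec_def)
qed (use A B in auto)

section \<open>Traces and finite sums of matrices\<close>

lemma mat_trace_carrier: "A \<in> carrier_mat n n \<Longrightarrow> mat_trace A = (\<Sum>i<n. A $$ (i, i))"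
  by (auto simp: mat_trace_def)

lemma mat_trace_comm:
  assumes "A \<in> carrier_mat n m" "B \<in> carrier_mat m n"
  shows "mat_trace (A * B) = mat_trace (B * A)"
proof -
  have "mat_trace (A * B) = (\<Sum>i<n. \<Sum>l<m. A $$ (i, l) * B $$ (l, i))"
    using assms by (simp add: mat_trace_carrier[of _ n] index_mult_mat_sum[of A n m B n] del: index_mult_mat)
  also have "\<dots> = (\<Sum>l<m. \<Sum>i<n. B $$ (l, i) * A $$ (i, l))"
    by (subst sum.swap) (simp add: mult.commute)
  also have "\<dots> = mat_trace (B * A)"
    using assms by (simp add: mat_trace_carrier[of _ m] index_mult_mat_sum[of B m n A m] del: index_mult_mat)
  finally show ?thesis .
qed

lemma mat_trace_one: "mat_trace (1\<^sub>m n) = of_nat n"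
  by (simp add: mat_trace_def)

lemma mat_trace_add:
  assumes "A \<in> carrier_mat n n" "B \<in> carrier_mat n n"
  shows "mat_trace (A + B) = mat_trace A + mat_trace B"
  using assms by (simp add: mat_trace_carrier[of _ n] sum.distrib)

lemma mat_trace_smult:
  assumes "A \<in> carrier_mat n n"
  shows "mat_trace (c \<cdot>\<^sub>m A) = c * mat_trace A"
  using assms by (simp add: mat_trace_carrier[of _ n] sum_distrib_left)

text \<open>The zero matrix depends on its dimensions, so \<^term>\<open>sum\<close> is not available for matrices.\<close>

definition mat_sum :: "nat \<Rightarrow> nat \<Rightarrow> ('i \<Rightarrow> complex mat) \<Rightarrow> 'i set \<Rightarrow> complex mat" where
  "mat_sum n m f S = Matrix.mat n m (\<lambda>(i, j). \<Sum>x\<in>S. f x $$ (i, j))"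

lemma mat_sum_carrier [simp]: "mat_sum n m f S \<in> carrier_mat n m"
  by (simp add: mat_sum_def)

lemma index_mat_sum: "i < n \<Longrightarrow> j < m \<Longrightarrow> mat_sum n m f S $$ (i, j) = (\<Sum>x\<in>S. f x $$ (i, j))"
  by (simp add: mat_sum_def)

lemma mat_sum_cong: "(\<And>x. x \<in> S \<Longrightarrow> f x = g x) \<Longrightarrow> mat_sum n m f S = mat_sum n m g S"
  by (simp add: mat_sum_def)

lemma mat_sum_reindex:
  "bij_betw h S T \<Longrightarrow> mat_sum n m (\<lambda>x. f (h x)) S = mat_sum n m f T"
  unfolding mat_sum_def by (intro cong_mat) (auto simp: sum.reindex_bij_betw[symmetric])

lemma mult_mat_sum:
  assumes A: "A \<in> carrier_mat n k" and f: "\<And>x. x \<in> S \<Longrightarrow> f x \<in> carrier_mat k m"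
  shows "A * mat_sum k m f S = mat_sum n m (\<lambda>x. A * f x) S"
proof (rule eq_matI)
  fix i j assume "i < dim_row (mat_sum n m (\<lambda>x. A * f x) S)" "j < dim_col (mat_sum n m (\<lambda>x. A * f x) S)"
  then have i: "i < n" and j: "j < m" by (auto simp: mat_sum_def)
  have "(A * mat_sum k m f S) $$ (i, j) = (\<Sum>l<k. \<Sum>x\<in>S. A $$ (i, l) * f x $$ (l, j))"
    using index_mult_mat_sum[OF A mat_sum_carrier i j] j by (simp add: index_mat_sum sum_distrib_left)
  also have "\<dots> = (\<Sum>x\<in>S. (A * f x) $$ (i, j))"
    by (subst sum.swap) (use index_mult_mat_sum[OF A f i j] in simp)
  finally show "(A * mat_sum k m f S) $$ (i, j) = mat_sum n m (\<lambda>x. A * f x) S $$ (i, j)"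
    using i j by (simp add: index_mat_sum)
qed (use A in \<open>auto simp: mat_sum_def\<close>)

lemma mat_sum_mult:
  assumes A: "A \<in> carrier_mat m k" and f: "\<And>x. x \<in> S \<Longrightarrow> f x \<in> carrier_mat n m"
  shows "mat_sum n m f S * A = mat_sum n k (\<lambda>x. f x * A) S"
proof (rule eq_matI)
  fix i j assume "i < dim_row (mat_sum n k (\<lambda>x. f x * A) S)" "j < dim_col (mat_sum n k (\<lambda>x. f x * A) S)"
  then have i: "i < n" and j: "j < k" by (auto simp: mat_sum_def)
  have "(mat_sum n m f S * A) $$ (i, j) = (\<Sum>l<m. \<Sum>x\<in>S. f x $$ (i, l) * A $$ (l, j))"
    using index_mult_mat_sum[OF mat_sum_carrier A i j] i by (simp add: index_mat_sum sum_distrib_right)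
  also have "\<dots> = (\<Sum>x\<in>S. (f x * A) $$ (i, j))"
    by (subst sum.swap) (use index_mult_mat_sum[OF f A i j] in simp)
  finally show "(mat_sum n m f S * A) $$ (i, j) = mat_sum n k (\<lambda>x. f x * A) S $$ (i, j)"
    using i j by (simp add: index_mat_sum)
qed (use A in \<open>auto simp: mat_sum_def\<close>)

lemma mat_trace_mat_sum:
  assumes "\<And>x. x \<in> S \<Longrightarrow> f x \<in> carrier_mat n n"
  shows "mat_trace (mat_sum n n f S) = (\<Sum>x\<in>S. mat_trace (f x))"
  by (simp add: mat_trace_carrier[of _ n] assms index_mat_sum) (rule sum.swap)

lemma mat_sum_const:
  assumes "A \<in> carrier_mat n m"
  shows "mat_sum n m (\<lambda>x. A) S = of_nat (card S) \<cdot>\<^sub>m A"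
  using assms by (intro eq_matI) (auto simp: index_mat_sum mat_sum_def)

section \<open>Coordinates on subspaces and on images of idempotents\<close>

text \<open>If \<open>k > n\<close>, padding both factors with zeros to size \<open>k\<close> keeps
  the product equal to the identity. A one-sided inverse of a square matrix is two-sided, but in the
  reversed product row \<open>n\<close> is zero.\<close>

lemma card_le_of_left_inverse:
  fixes B Q :: "complex mat"
  assumes B: "B \<in> carrier_mat n k" and Q: "Q \<in> carrier_mat k n" and QB: "Q * B = 1\<^sub>m k"
  shows "k \<le> n"
proof (rule ccontr)
  assume "\<not> k \<le> n"
  define B' where "B' = Matrix.mat k k (\<lambda>(i, j). if i < n then B $$ (i, j) else 0)"
  define Q' where "Q' = Matrix.mat k k (\<lambda>(i, j). if j < n then Q $$ (i, j) else 0)"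
  have car: "B' \<in> carrier_mat k k" "Q' \<in> carrier_mat k k"
    by (auto simp: B'_def Q'_def)
  have "Q' * B' = 1\<^sub>m k"
  proof (rule eq_matI)
    fix i j assume "i < dim_row (1\<^sub>m k)" "j < dim_col (1\<^sub>m k)"
    then have ij: "i < k" "j < k" by auto
    have "(Q' * B') $$ (i, j) = (\<Sum>l<k. if l < n then Q $$ (i, l) * B $$ (l, j) else 0)"
      unfolding index_mult_mat_sum[OF car(2,1) ij]
      by (rule sum.cong) (use ij in \<open>auto simp: B'_def Q'_def\<close>)
    also have "\<dots> = (\<Sum>l<n. Q $$ (i, l) * B $$ (l, j))"
      by (rule sum.mono_neutral_cong_right) (use \<open>\<not> k \<le> n\<close> in auto)
    also have "\<dots> = (Q * B) $$ (i, j)"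
      using index_mult_mat_sum[OF Q B ij] by simp
    finally show "(Q' * B') $$ (i, j) = 1\<^sub>m k $$ (i, j)" by (simp add: QB)
  qed (auto simp: B'_def Q'_def)
  then have "B' * Q' = 1\<^sub>m k"
    using mat_mult_left_right_inverse car by blast
  moreover have "(B' * Q') $$ (n, n) = 0"
    using \<open>\<not> k \<le> n\<close> by (subst index_mult_mat_sum[OF car]) (auto simp: B'_def)
  ultimately show False using \<open>\<not> k \<le> n\<close> by simp
qed

text \<open>A maximal pair \<open>(B, Q)\<close> works: a vector \<open>w\<close> outside the image of \<open>B\<close> gives the new
  column \<open>v = w - B Q w\<close>, and a rescaled row of \<open>1 - B Q\<close> gives the new row of \<open>Q\<close>.\<close>

lemma subspace_coordinates:
  fixes W :: "complex Matrix.vec set"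
  assumes sub: "W \<subseteq> carrier_vec n" and zero: "0\<^sub>v n \<in> W"
    and add: "\<And>v w. v \<in> W \<Longrightarrow> w \<in> W \<Longrightarrow> v + w \<in> W"
    and smult: "\<And>c v. v \<in> W \<Longrightarrow> c \<cdot>\<^sub>v v \<in> W"
  obtains k B Q where "B \<in> carrier_mat n k" "Q \<in> carrier_mat k n" "Q * B = 1\<^sub>m k"
    "\<And>v. v \<in> carrier_vec k \<Longrightarrow> B *\<^sub>v v \<in> W" "\<And>w. w \<in> W \<Longrightarrow> B *\<^sub>v (Q *\<^sub>v w) = w"
proof -
  define P where "P k \<longleftrightarrow> (\<exists>B Q. B \<in> carrier_mat n k \<and> Q \<in> carrier_mat k n \<and> Q * B = 1\<^sub>m k \<and>
    (\<forall>v\<in>carrier_vec k. B *\<^sub>v v \<in> W))" for k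
  have "P 0"
    unfolding P_def
  proof (intro exI conjI ballI)
    fix v :: "complex Matrix.vec"
    assume "v \<in> carrier_vec 0"
    then have "0\<^sub>m n 0 *\<^sub>v v = 0\<^sub>v n" by (intro eq_vecI) (auto simp: scalar_prod_def)
    then show "0\<^sub>m n 0 *\<^sub>v v \<in> W" using zero by simp
  qed (auto intro: eq_matI)
  moreover have "k \<le> n" if "P k" for k
    using that card_le_of_left_inverse unfolding P_def by blast
  ultimately obtain k where k: "P k" and max: "\<And>l. P l \<Longrightarrow> l \<le> k"
    using GreatestI_nat[of P 0 n] Greatest_le_nat[of P _ n] by blast
  then obtain B Q where B: "B \<in> carrier_mat n k" and Q: "Q \<in> carrier_mat k n" and QB: "Q * B = 1\<^sub>m k"
    and BW: "\<And>v. v \<in> carrier_vec k \<Longrightarrow> B *\<^sub>v v \<in> W"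
    unfolding P_def by blast
  have "B *\<^sub>v (Q *\<^sub>v w) = w" if w: "w \<in> W" for w
  proof (rule ccontr)
    assume ne: "B *\<^sub>v (Q *\<^sub>v w) \<noteq> w"
    have wn: "w \<in> carrier_vec n" using w sub by blast
    have BQw: "B *\<^sub>v (Q *\<^sub>v w) \<in> carrier_vec n"
      using mult_mat_vec_carrier[OF B mult_mat_vec_carrier[OF Q wn]] .
    define v where "v = w + (-1) \<cdot>\<^sub>v (B *\<^sub>v (Q *\<^sub>v w))"
    have vW: "v \<in> W"
      unfolding v_def by (intro add smult w BW) (use Q wn in auto)
    have v: "v \<in> carrier_vec n" using vW sub by blast
    have vw: "v = w - B *\<^sub>v (Q *\<^sub>v w)"
      using wn BQw unfolding v_def by (intro eq_vecI) auto
    have QBx: "Q *\<^sub>v (B *\<^sub>v x) = x" if "x \<in> carrier_vec k" for x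
      using that by (simp add: assoc_mult_mat_vec[OF Q B, symmetric] QB)
    have Qv: "Q *\<^sub>v v = 0\<^sub>v k"
      unfolding vw using Q wn BQw by (subst mult_minus_distrib_mat_vec[OF Q]) (auto simp: QBx)
    have "\<exists>a<n. v $ a \<noteq> 0"
    proof (rule ccontr)
      assume "\<not> (\<exists>a<n. v $ a \<noteq> 0)"
      then have "v $ i = 0" if "i < n" for i using that by blast
      then have "(B *\<^sub>v (Q *\<^sub>v w)) $ i = w $ i" if "i < n" for i
        using that BQw wn unfolding vw by (metis carrier_vecD eq_iff_diff_eq_0 index_minus_vec(1))
      then have "B *\<^sub>v (Q *\<^sub>v w) = w" using BQw wn B by (intro eq_vecI) auto
      then show False using ne by simp
    qed
    then obtain a where a: "a < n" "v $ a \<noteq> 0" by blast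
    \<comment> \<open>\<open>M\<close> kills the columns of \<open>B\<close> and fixes
      \<open>v\<close>. Its row \<open>a\<close>, divided by \<open>v $ a\<close>, therefore gives 0
      on the old columns and 1 on the new one, while the old rows of \<open>Q\<close> give 0 on
      \<open>v\<close> by \<open>Qv\<close>.\<close>
    define M where "M = 1\<^sub>m n - B * Q"
    have M: "M \<in> carrier_mat n n" using B Q by (auto simp: M_def)
    have MB: "M * B = 0\<^sub>m n k"
      unfolding M_def using B Q
      by (subst minus_mult_distrib_mat[of _ n n _ _ k]) (auto simp: QB)
    have Mvv: "M *\<^sub>v v = v"
      unfolding M_def using B Q v
      by (subst minus_mult_distrib_mat_vec[of _ n n]) (auto simp: assoc_mult_mat_vec[OF B Q] Qv)
    have Mv: "(\<Sum>l<n. M $$ (a, l) * v $ l) = v $ a"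
      using arg_cong[of _ _ "\<lambda>u. u $ a", OF Mvv] a v M
      by (simp add: mult_mat_vec_def scalar_prod_def atLeast0LessThan)
    define B' where "B' = Matrix.mat n (Suc k) (\<lambda>(i, j). if j < k then B $$ (i, j) else v $ i)"
    define Q' where "Q' = Matrix.mat (Suc k) n (\<lambda>(i, j). if i < k then Q $$ (i, j) else M $$ (a, j) / v $ a)"
    have B': "B' \<in> carrier_mat n (Suc k)" and Q': "Q' \<in> carrier_mat (Suc k) n"
      by (auto simp: B'_def Q'_def)
    have "Q' * B' = 1\<^sub>m (Suc k)"
    proof (rule eq_matI)
      fix i j assume "i < dim_row (1\<^sub>m (Suc k) :: complex mat)" "j < dim_col (1\<^sub>m (Suc k) :: complex mat)"
      then have ij: "i < Suc k" "j < Suc k" by auto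
      have *: "(Q' * B') $$ (i, j) = (\<Sum>l<n. Q' $$ (i, l) * B' $$ (l, j))"
        by (rule index_mult_mat_sum[OF Q' B' ij])
      consider "i < k" "j < k" | "i < k" "j = k" | "i = k" "j < k" | "i = k" "j = k"
        using ij by linarith
      then show "(Q' * B') $$ (i, j) = 1\<^sub>m (Suc k) $$ (i, j)"
      proof cases
        case 1
        then have "(Q' * B') $$ (i, j) = (Q * B) $$ (i, j)"
          unfolding * index_mult_mat_sum[OF Q B 1] by (auto simp: B'_def Q'_def)
        then show ?thesis using 1 by (simp add: QB)
      next
        case 2
        then have "(Q' * B') $$ (i, j) = (Q *\<^sub>v v) $ i"
          unfolding * using Q v by (auto simp: B'_def Q'_def mult_mat_vec_def scalar_prod_def atLeast0LessThan)
        then show ?thesis using 2 by (simp add: Qv)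
      next
        case 3
        then have "(Q' * B') $$ (i, j) = (M * B) $$ (a, j) / v $ a"
          unfolding * index_mult_mat_sum[OF M B a(1) 3(2)] by (auto simp: B'_def Q'_def sum_divide_distrib)
        then show ?thesis using 3 a by (simp add: MB)
      next
        case 4
        then have "(Q' * B') $$ (i, j) = (\<Sum>l<n. M $$ (a, l) * v $ l) / v $ a"
          unfolding * by (auto simp: B'_def Q'_def sum_divide_distrib)
        then show ?thesis using 4 a by (simp add: Mv)
      qed
    qed (auto simp: B'_def Q'_def)
    moreover have "B' *\<^sub>v u \<in> W" if u: "u \<in> carrier_vec (Suc k)" for u
    proof -
      define u' where "u' = Matrix.vec k (\<lambda>i. u $ i)"
      have "B' *\<^sub>v u = B *\<^sub>v u' + (u $ k) \<cdot>\<^sub>v v"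
        using B v u by (intro eq_vecI) (auto simp: B'_def u'_def mult_mat_vec_def scalar_prod_def atLeast0LessThan)
      then show ?thesis
        by (auto intro!: add smult vW BW simp: u'_def)
    qed
    ultimately have "P (Suc k)" unfolding P_def using B' Q' by blast
    then show False using max by force
  qed
  with B Q QB BW show thesis by (rule that)
qed

text \<open>The image of an idempotent is its space of fixed vectors, and coordinates on that space
  factor it.\<close>

lemma idempotent_factorization:
  fixes P :: "complex mat"
  assumes P: "P \<in> carrier_mat n n" and PP: "P * P = P"
  obtains k B Q where "B \<in> carrier_mat n k" "Q \<in> carrier_mat k n" "Q * B = 1\<^sub>m k" "B * Q = P"
proof -
  define W where "W = {v \<in> carrier_vec n. P *\<^sub>v v = v}"
  obtain k B Q where B: "B \<in> carrier_mat n k" and Q: "Q \<in> carrier_mat k n" and QB: "Q * B = 1\<^sub>m k"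
    and BW: "\<And>v. v \<in> carrier_vec k \<Longrightarrow> B *\<^sub>v v \<in> W" and WB: "\<And>w. w \<in> W \<Longrightarrow> B *\<^sub>v (Q *\<^sub>v w) = w"
  proof (rule subspace_coordinates[of W n])
    show "0\<^sub>v n \<in> W" using P by (auto simp: W_def)
    show "v + w \<in> W" if "v \<in> W" "w \<in> W" for v w
      using that P by (auto simp: W_def mult_add_distrib_mat_vec)
    show "c \<cdot>\<^sub>v v \<in> W" if "v \<in> W" for c v
      using that P by (auto simp: W_def mult_mat_vec)
  qed (auto simp: W_def)
  have PB: "P * B = B"
  proof (rule mat_eq_vecI)
    fix v :: "complex Matrix.vec" assume "v \<in> carrier_vec k"
    then show "P * B *\<^sub>v v = B *\<^sub>v v" using BW P B by (auto simp: W_def)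
  qed (use P B in auto)
  have BQP: "B * (Q * P) = P"
  proof (rule mat_eq_vecI)
    fix v :: "complex Matrix.vec" assume v: "v \<in> carrier_vec n"
    have "P *\<^sub>v (P *\<^sub>v v) = P *\<^sub>v v" using P v by (simp add: assoc_mult_mat_vec[OF P P, symmetric] PP)
    then have "P *\<^sub>v v \<in> W" using v P by (auto simp: W_def)
    moreover have "B * (Q * P) *\<^sub>v v = B *\<^sub>v (Q *\<^sub>v (P *\<^sub>v v))"
      using v P B Q by (simp add: assoc_mult_mat_vec[of B n k _ n])
    ultimately show "B * (Q * P) *\<^sub>v v = P *\<^sub>v v" using WB by metis
  qed (use P B Q in auto)
  \<comment> \<open>\<open>Q\<close> inverts \<open>B\<close> on the image of \<open>P\<close> but
    need not vanish on the kernel of \<open>P\<close>; composing it with \<open>P\<close> enforces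
    this.\<close>
  show thesis
  proof (rule that[of B k "Q * P"])
    show "Q * P * B = 1\<^sub>m k" using P B Q by (simp add: PB QB)
  qed (use P B Q BQP in auto)
qed

section \<open>Complex representations of a finite group\<close>

locale finite_group = group +
  assumes finite_carrier: "finite (carrier G)"
begin

lemma card_carrier_pos: "card (carrier G) > 0"
  using finite_carrier by (metis card_gt_0_iff empty_iff one_closed)

lemma bij_betw_mult_left: "h \<in> carrier G \<Longrightarrow> bij_betw (\<lambda>g. h \<otimes> g) (carrier G) (carrier G)"
  by (rule bij_betwI[where g = "\<lambda>g. inv h \<otimes> g"]) (auto simp: m_assoc[symmetric])

lemma hom_GL_complexI:
  assumes car: "\<And>g. g \<in> carrier G \<Longrightarrow> R g \<in> carrier_mat n n" and one: "R \<one> = 1\<^sub>m n"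
    and mult: "\<And>g h. g \<in> carrier G \<Longrightarrow> h \<in> carrier G \<Longrightarrow> R (g \<otimes> h) = R g * R h"
  shows "R \<in> hom G (GL_complex n)"
proof (rule homI)
  fix g assume g: "g \<in> carrier G"
  have "R (inv g) * R g = 1\<^sub>m n" "R g * R (inv g) = 1\<^sub>m n"
    using mult[of "inv g" g] mult[of g "inv g"] g one by auto
  then show "R g \<in> carrier (GL_complex n)"
    using car g by (auto simp: GL_complex_def units_of_def Units_def ring_mat_simps intro!: bexI[of _ "R (inv g)"])
qed (auto simp: GL_complex_def units_of_def ring_mat_simps mult)

context
  fixes n :: nat and R :: "'a \<Rightarrow> complex mat"
  assumes R: "R \<in> hom G (GL_complex n)"
begin

lemma rep_carrier: "g \<in> carrier G \<Longrightarrow> R g \<in> carrier_mat n n"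
  using hom_in_carrier[OF R] by (auto simp: GL_complex_def units_of_def Units_def ring_mat_simps)

lemma rep_mult: "g \<in> carrier G \<Longrightarrow> h \<in> carrier G \<Longrightarrow> R (g \<otimes> h) = R g * R h"
  using hom_mult[OF R] by (auto simp: GL_complex_def units_of_def ring_mat_simps)

text \<open>An idempotent with a left inverse is the identity.\<close>

lemma rep_one: "R \<one> = 1\<^sub>m n"
proof -
  have "R \<one> \<in> carrier (GL_complex n)" using hom_in_carrier[OF R] by simp
  then obtain U where U: "U \<in> carrier_mat n n" "U * R \<one> = 1\<^sub>m n"
    by (auto simp: GL_complex_def units_of_def Units_def ring_mat_simps)
  have c: "R \<one> \<in> carrier_mat n n" by (simp add: rep_carrier)
  have "U * (R \<one> * R \<one>) = 1\<^sub>m n * R \<one>"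
    by (rule mult_mult_eq[OF U(2,1) c c])
  then show ?thesis
    using U c rep_mult[of \<one> \<one>] by simp
qed

lemma rep_inv_mult: "g \<in> carrier G \<Longrightarrow> R (inv g) * R g = 1\<^sub>m n"
  using rep_mult[of "inv g" g] rep_one by simp

lemma rep_mult_inv: "g \<in> carrier G \<Longrightarrow> R g * R (inv g) = 1\<^sub>m n"
  using rep_mult[of g "inv g"] rep_one by simp

end

lemmas irreducible_rep_hom = irreducible_rep_def[THEN iffD1, THEN conjunct1]

lemma irreducible_rep_degree_pos: "irreducible_rep G n R \<Longrightarrow> n > 0"
  by (simp add: irreducible_rep_def)

lemma submodule_module_vec_iff:
  fixes W :: "complex Matrix.vec set"
  shows "submodule class_ring W (module_vec TYPE(complex) n) \<longleftrightarrow>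
    W \<subseteq> carrier_vec n \<and> 0\<^sub>v n \<in> W \<and> (\<forall>v\<in>W. \<forall>w\<in>W. v + w \<in> W) \<and> (\<forall>c. \<forall>v\<in>W. c \<cdot>\<^sub>v v \<in> W)"
  by (auto simp: submodule_def module_vec_simps vec_module)

lemma irreducible_rep_invariant:
  assumes "irreducible_rep G n R"
    and "W \<subseteq> carrier_vec n" "0\<^sub>v n \<in> W" "\<And>v w. v \<in> W \<Longrightarrow> w \<in> W \<Longrightarrow> v + w \<in> W"
    and "\<And>c v. v \<in> W \<Longrightarrow> c \<cdot>\<^sub>v v \<in> W"
    and "\<And>g w. g \<in> carrier G \<Longrightarrow> w \<in> W \<Longrightarrow> R g *\<^sub>v w \<in> W"
  shows "W = {0\<^sub>v n} \<or> W = carrier_vec n"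
proof -
  have "submodule class_ring W (module_vec TYPE(complex) n)"
    unfolding submodule_module_vec_iff using assms(2-5) by blast
  moreover have "\<forall>g\<in>carrier G. \<forall>w\<in>W. R g *\<^sub>v w \<in> W" using assms(6) by blast
  ultimately show ?thesis using assms(1) unfolding irreducible_rep_def by blast
qed

section \<open>Schur's lemma and averaging over the group\<close>

text \<open>Kernel and image of an intertwiner are invariant, so a nonzero one has kernel zero and
  full image. The degrees are not known to agree beforehand, so both one-sided inverse laws are
  proved.\<close>

lemma schur_invertible:
  assumes R: "irreducible_rep G n R" and S: "irreducible_rep G m S"
    and T: "T \<in> carrier_mat n m" "T \<noteq> 0\<^sub>m n m"
    and comm: "\<And>g. g \<in> carrier G \<Longrightarrow> R g * T = T * S g"
  obtains U where "U \<in> carrier_mat m n" "T * U = 1\<^sub>m n" "U * T = 1\<^sub>m m"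
proof -
  note Rc = rep_carrier[OF irreducible_rep_hom[OF R]] and Sc = rep_carrier[OF irreducible_rep_hom[OF S]]
  have comm_vec: "T *\<^sub>v (S g *\<^sub>v v) = R g *\<^sub>v (T *\<^sub>v v)" if "g \<in> carrier G" "v \<in> carrier_vec m" for g v
  proof -
    have "T *\<^sub>v (S g *\<^sub>v v) = (R g * T) *\<^sub>v v"
      using that T Sc comm by (intro mult_mult_vec_eq[of _ _ _ n m m]) auto
    then show ?thesis
      using that T Rc by (simp add: assoc_mult_mat_vec[of _ n n _ m])
  qed
  have T_zero: "T = 0\<^sub>m n m" if "\<And>v. v \<in> carrier_vec m \<Longrightarrow> T *\<^sub>v v = 0\<^sub>v n"
    using T that by (intro mat_eq_vecI) auto
  define K where "K = {v \<in> carrier_vec m. T *\<^sub>v v = 0\<^sub>v n}"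
  have "K = {0\<^sub>v m} \<or> K = carrier_vec m"
  proof (rule irreducible_rep_invariant[OF S])
    show "v + w \<in> K" if "v \<in> K" "w \<in> K" for v w
      using that T by (auto simp: K_def mult_add_distrib_mat_vec)
    show "c \<cdot>\<^sub>v v \<in> K" if "v \<in> K" for c v
      using that T by (auto simp: K_def mult_mat_vec)
    show "S g *\<^sub>v v \<in> K" if "g \<in> carrier G" "v \<in> K" for g v
      using that Sc[OF that(1)] Rc[OF that(1)] by (auto simp: K_def comm_vec)
  qed (use T in \<open>auto simp: K_def\<close>)
  then have K: "K = {0\<^sub>v m}" using T_zero T by (auto simp: K_def)
  define I where "I = (\<lambda>v. T *\<^sub>v v) ` carrier_vec m"
  have "I = {0\<^sub>v n} \<or> I = carrier_vec n"
  proof (rule irreducible_rep_invariant[OF R])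
    show "I \<subseteq> carrier_vec n" using T by (auto simp: I_def)
    show "0\<^sub>v n \<in> I" unfolding I_def by (rule image_eqI[of _ _ "0\<^sub>v m"]) (use T in auto)
    show "v + w \<in> I" if v: "v \<in> I" and w: "w \<in> I" for v w
    proof -
      obtain x y where "x \<in> carrier_vec m" "y \<in> carrier_vec m" "v = T *\<^sub>v x" "w = T *\<^sub>v y"
        using v w by (auto simp: I_def)
      then show ?thesis unfolding I_def
        by (intro image_eqI[of _ _ "x + y"]) (use T in \<open>auto simp: mult_add_distrib_mat_vec\<close>)
    qed
    show "c \<cdot>\<^sub>v v \<in> I" if v: "v \<in> I" for c v
    proof -
      obtain x where "x \<in> carrier_vec m" "v = T *\<^sub>v x"
        using v by (auto simp: I_def)
      then show ?thesis unfolding I_def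
        by (intro image_eqI[of _ _ "c \<cdot>\<^sub>v x"]) (use T in \<open>auto simp: mult_mat_vec\<close>)
    qed
    show "R g *\<^sub>v v \<in> I" if g: "g \<in> carrier G" and v: "v \<in> I" for g v
    proof -
      obtain x where "x \<in> carrier_vec m" "v = T *\<^sub>v x"
        using v by (auto simp: I_def)
      then show ?thesis unfolding I_def
        by (intro image_eqI[of _ _ "S g *\<^sub>v x"]) (use Sc[OF g] g in \<open>auto simp: comm_vec\<close>)
    qed
  qed
  then have I: "I = carrier_vec n" using T_zero T unfolding I_def by (metis image_eqI singletonD)
  have "\<exists>u. u \<in> carrier_vec m \<and> T *\<^sub>v u = unit_vec n i" for i
    using I unfolding I_def by (metis imageE unit_vec_carrier)
  then obtain u where u: "\<And>i. u i \<in> carrier_vec m" "\<And>i. T *\<^sub>v u i = unit_vec n i"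
    by metis
  \<comment> \<open>The columns of \<open>U\<close> are preimages of the unit vectors. This gives
    the right inverse; \<open>U * T\<close> is then the identity because it differs from it only by
    vectors in the trivial kernel \<open>K\<close>.\<close>
  define U where "U = Matrix.mat m n (\<lambda>(j, i). u i $ j)"
  have U: "U \<in> carrier_mat m n" by (simp add: U_def)
  have TU: "T * U = 1\<^sub>m n"
  proof (rule eq_matI)
    fix i j assume "i < dim_row (1\<^sub>m n :: complex mat)" "j < dim_col (1\<^sub>m n :: complex mat)"
    then have ij: "i < n" "j < n" by auto
    have "(T * U) $$ (i, j) = (T *\<^sub>v u j) $ i"
      unfolding index_mult_mat_sum[OF T(1) U ij]
      using T u(1)[of j] ij by (auto simp: U_def mult_mat_vec_def scalar_prod_def atLeast0LessThan)
    then show "(T * U) $$ (i, j) = 1\<^sub>m n $$ (i, j)" using ij by (auto simp: u)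
  qed (use T U in auto)
  moreover have "U * T = 1\<^sub>m m"
  proof (rule mat_eq_vecI)
    fix v :: "complex Matrix.vec" assume v: "v \<in> carrier_vec m"
    note Tv = mult_mat_vec_carrier[OF T(1) v] and UTv = mult_mat_vec_carrier[OF U mult_mat_vec_carrier[OF T(1) v]]
    have "T *\<^sub>v (U *\<^sub>v (T *\<^sub>v v)) = T *\<^sub>v v"
      using mult_mult_vec_eq[OF TU T(1) U Tv] Tv by simp
    then have "U *\<^sub>v (T *\<^sub>v v) - v \<in> K"
      using UTv v T Tv by (auto simp: K_def mult_minus_distrib_mat_vec)
    then have diff: "U *\<^sub>v (T *\<^sub>v v) - v = 0\<^sub>v m" using K by auto
    have "U *\<^sub>v (T *\<^sub>v v) = v"
    proof (rule eq_vecI)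
      fix i assume "i < dim_vec v"
      then show "(U *\<^sub>v (T *\<^sub>v v)) $ i = v $ i"
        using arg_cong[OF diff, of "\<lambda>x. x $ i"] UTv v by simp
    qed (use UTv v U in auto)
    then show "U * T *\<^sub>v v = 1\<^sub>m m *\<^sub>v v" using U T v by simp
  qed (use T U in auto)
  ultimately show thesis using U that by blast
qed

text \<open>Over the complex numbers \<open>T\<close> has an eigenvalue \<open>c\<close>. The
  intertwiner \<open>T - c\<close> kills an eigenvector, so it is not invertible and must
  vanish.\<close>

lemma schur_scalar:
  assumes R: "irreducible_rep G n R" and T: "T \<in> carrier_mat n n"
    and comm: "\<And>g. g \<in> carrier G \<Longrightarrow> R g * T = T * R g"
  obtains c where "T = c \<cdot>\<^sub>m 1\<^sub>m n"
proof -
  note Rc = rep_carrier[OF irreducible_rep_hom[OF R]]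
  obtain c v where v: "v \<in> carrier_vec n" "v \<noteq> 0\<^sub>v n" "T *\<^sub>v v = c \<cdot>\<^sub>v v"
    using spectrum_non_empty[OF T irreducible_rep_degree_pos[OF R]] T
    by (auto simp: spectrum_def eigenvalue_def eigenvector_def)
  define M where "M = T - c \<cdot>\<^sub>m 1\<^sub>m n"
  have M: "M \<in> carrier_mat n n" unfolding M_def by (rule minus_carrier_mat) simp
  have Mv: "M *\<^sub>v v = 0\<^sub>v n"
    unfolding M_def using T v by (subst minus_mult_distrib_mat_vec[of _ n n]) auto
  have "M = 0\<^sub>m n n"
  proof (rule ccontr)
    assume "M \<noteq> 0\<^sub>m n n"
    moreover have "R g * M = M * R g" if "g \<in> carrier G" for g
      using that Rc[OF that] T comm[OF that]
      by (simp add: M_def minus_mult_distrib_mat[of _ n n] mult_minus_distrib_mat[of _ n n]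
          mult_smult_distrib[of _ n n _ n] mult_smult_assoc_mat[of _ n n _ n])
    ultimately obtain U where U: "U \<in> carrier_mat n n" "U * M = 1\<^sub>m n"
      using schur_invertible[OF R R M] by blast
    have "v = U *\<^sub>v (M *\<^sub>v v)"
      using mult_mult_vec_eq[OF U(2,1) M v(1)] v by simp
    also have "\<dots> = 0\<^sub>v n" using U unfolding Mv by (intro eq_vecI) auto
    finally show False using v by simp
  qed
  have "T = c \<cdot>\<^sub>m 1\<^sub>m n"
  proof (rule eq_matI)
    fix i j assume "i < dim_row (c \<cdot>\<^sub>m 1\<^sub>m n)" "j < dim_col (c \<cdot>\<^sub>m 1\<^sub>m n)"
    then show "T $$ (i, j) = (c \<cdot>\<^sub>m 1\<^sub>m n) $$ (i, j)"
      using arg_cong[OF \<open>M = 0\<^sub>m n n\<close>, of "\<lambda>A. A $$ (i, j)"] T by (simp add: M_def)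
  qed (use T in auto)
  then show thesis by (rule that)
qed

text \<open>Left multiplication by \<open>R h\<close> permutes the summands through g -> hg, and
  what is left over on the right of each summand is \<open>S h\<close>.\<close>

lemma averaging_intertwines:
  assumes R: "R \<in> hom G (GL_complex n)" and S: "S \<in> hom G (GL_complex m)"
    and X: "X \<in> carrier_mat n m" and h: "h \<in> carrier G"
  defines "T \<equiv> mat_sum n m (\<lambda>g. R g * X * S (inv g)) (carrier G)"
  shows "R h * T = T * S h"
proof -
  note Rc = rep_carrier[OF R] and Sc = rep_carrier[OF S]
  have f: "R g * X * S (inv g) \<in> carrier_mat n m" if "g \<in> carrier G" for g
    using Rc[OF that] Sc[of "inv g"] that X by auto
  have "R h * T = mat_sum n m (\<lambda>g. R h * (R g * X * S (inv g))) (carrier G)"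
    unfolding T_def by (rule mult_mat_sum[OF Rc[OF h] f])
  also have "\<dots> = mat_sum n m (\<lambda>g. R (h \<otimes> g) * X * S (inv (h \<otimes> g)) * S h) (carrier G)"
  proof (rule mat_sum_cong)
    fix g assume g: "g \<in> carrier G"
    have "S (inv g) = S (inv (h \<otimes> g)) * S h"
      using g h by (simp add: rep_mult[OF S, symmetric] inv_mult_group m_assoc)
    then show "R h * (R g * X * S (inv g)) = R (h \<otimes> g) * X * S (inv (h \<otimes> g)) * S h"
      using g h X Rc[OF g] Rc[OF h] Sc[OF h] Sc[of "inv (h \<otimes> g)"]
      by (simp add: rep_mult[OF R] assoc_mult_mat[of _ n n _ n _ m] assoc_mult_mat[of _ n n _ m _ m]
          assoc_mult_mat[of _ n m _ m _ m])
  qed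
  also have "\<dots> = mat_sum n m (\<lambda>g. R g * X * S (inv g) * S h) (carrier G)"
    by (rule mat_sum_reindex[OF bij_betw_mult_left[OF h]])
  also have "\<dots> = T * S h"
    unfolding T_def by (rule mat_sum_mult[OF Sc[OF h] f, symmetric])
  finally show ?thesis .
qed

text \<open>A nonzero average would be an invertible intertwiner, which makes \<open>R\<close> and
  \<open>S\<close> conjugate and their traces equal. Non-equivalence is thus expressed by
  characters, the form in which constituents are given.\<close>

lemma schur_average_zero:
  assumes R: "irreducible_rep G n R" and S: "irreducible_rep G m S" and X: "X \<in> carrier_mat n m"
    and ne: "rep_character G R \<noteq> rep_character G S"
  shows "mat_sum n m (\<lambda>g. R g * X * S (inv g)) (carrier G) = 0\<^sub>m n m" (is "?T = _")
proof (rule ccontr)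
  note Rc = rep_carrier[OF irreducible_rep_hom[OF R]] and Sc = rep_carrier[OF irreducible_rep_hom[OF S]]
  note comm = averaging_intertwines[OF irreducible_rep_hom[OF R] irreducible_rep_hom[OF S] X]
  assume "?T \<noteq> 0\<^sub>m n m"
  then obtain U where U: "U \<in> carrier_mat m n" "?T * U = 1\<^sub>m n" "U * ?T = 1\<^sub>m m"
    using schur_invertible[OF R S _ _ comm] by auto
  have "mat_trace (R g) = mat_trace (S g)" if g: "g \<in> carrier G" for g
  proof -
    have "R g = R g * (?T * U)" using U Rc[OF g] by simp
    also have "\<dots> = (?T * S g) * U"
      by (rule mult_mult_eq[OF comm[OF g] Rc[OF g] mat_sum_carrier U(1)])
    also have "\<dots> = ?T * (S g * U)"
      by (rule assoc_mult_mat[OF mat_sum_carrier Sc[OF g] U(1)])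
    finally have "mat_trace (R g) = mat_trace (?T * (S g * U))" by simp
    also have "\<dots> = mat_trace ((S g * U) * ?T)"
      by (rule mat_trace_comm[OF mat_sum_carrier mult_carrier_mat[OF Sc[OF g] U(1)]])
    also have "(S g * U) * ?T = S g"
      using U Sc[OF g] by (simp add: assoc_mult_mat[OF Sc[OF g] U(1) mat_sum_carrier])
    finally show ?thesis .
  qed
  then have "rep_character G R = rep_character G S"
    unfolding rep_character_def by (intro restrict_ext)
  then show False using ne by simp
qed

text \<open>The scalar is found by comparing traces: each of the |G| summands is conjugate to
  \<open>X\<close>, and the identity has trace \<open>n\<close>.\<close>

lemma schur_average_scalar:
  assumes R: "irreducible_rep G n R" and X: "X \<in> carrier_mat n n"
  shows "mat_sum n n (\<lambda>g. R g * X * R (inv g)) (carrier G)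
    = (of_nat (card (carrier G)) * mat_trace X / of_nat n) \<cdot>\<^sub>m 1\<^sub>m n" (is "?T = _")
proof -
  note hom = irreducible_rep_hom[OF R]
  note Rc = rep_carrier[OF hom]
  obtain c where c: "?T = c \<cdot>\<^sub>m 1\<^sub>m n"
    by (rule schur_scalar[OF R mat_sum_carrier averaging_intertwines[OF hom hom X]])
  have "mat_trace ?T = (\<Sum>g\<in>carrier G. mat_trace (R g * X * R (inv g)))"
    by (rule mat_trace_mat_sum) (use Rc X in \<open>auto intro!: mult_carrier_mat\<close>)
  also have "\<dots> = (\<Sum>g\<in>carrier G. mat_trace X)"
  proof (rule sum.cong)
    fix g assume g: "g \<in> carrier G"
    have "mat_trace (R g * X * R (inv g)) = mat_trace (R (inv g) * (R g * X))"
      using Rc[of g] Rc[of "inv g"] X g by (intro mat_trace_comm[of _ n n]) auto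
    also have "R (inv g) * (R g * X) = X"
      using mult_mult_eq[OF rep_inv_mult[OF hom g] Rc Rc X] g X by simp
    finally show "mat_trace (R g * X * R (inv g)) = mat_trace X" .
  qed simp
  finally have "c * of_nat n = of_nat (card (carrier G)) * mat_trace X"
    by (simp add: c mat_trace_smult[of _ n] mat_trace_one)
  then have "c = of_nat (card (carrier G)) * mat_trace X / of_nat n"
    using irreducible_rep_degree_pos[OF R] by (simp add: field_simps)
  then show ?thesis using c by simp
qed

section \<open>Orthogonality relations and values at inverses\<close>

lemma rep_character_one:
  "R \<in> hom G (GL_complex n) \<Longrightarrow> rep_character G R \<one> = of_nat n"
  by (simp add: rep_character_def rep_one mat_trace_one)

text \<open>Schur orthogonality with \<open>X\<close> running through the elementary matrices, contracted over
  the second representation.\<close>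

lemma character_sum_rep:
  assumes R: "irreducible_rep G n R" and \<psi>: "irreducible_character G \<psi>"
  shows "mat_sum n n (\<lambda>g. \<psi> (inv g) \<cdot>\<^sub>m R g) (carrier G) =
    (if \<psi> = rep_character G R then of_nat (card (carrier G)) / of_nat n else 0) \<cdot>\<^sub>m 1\<^sub>m n"
    (is "_ = ?rhs")
proof (rule eq_matI)
  note Rc = rep_carrier[OF irreducible_rep_hom[OF R]]
  fix i j assume "i < dim_row ?rhs"
    "j < dim_col ?rhs"
  then have ij: "i < n" "j < n" by auto
  let ?E = "\<lambda>m k. Matrix.mat n m (\<lambda>(a, b). if a = j \<and> b = k then 1 else 0)"
  \<comment> \<open>With the elementary matrix at position \<open>(j, k)\<close>, the entry
    \<open>(i, k)\<close> of the summand is the entry \<open>(i, j)\<close> of \<open>R g\<close>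
    times the diagonal entry \<open>k\<close> of \<open>S (inv g)\<close>. Summing over
    \<open>k\<close> produces the character value.\<close>
  have expand: "mat_sum n n (\<lambda>g. \<psi> (inv g) \<cdot>\<^sub>m R g) (carrier G) $$ (i, j) =
    (\<Sum>k<m. mat_sum n m (\<lambda>g. R g * ?E m k * S (inv g)) (carrier G) $$ (i, k))"
    if S: "S \<in> hom G (GL_complex m)" and eq: "\<psi> = rep_character G S" for m S
  proof -
    note Sc = rep_carrier[OF S]
    have "mat_sum n n (\<lambda>g. \<psi> (inv g) \<cdot>\<^sub>m R g) (carrier G) $$ (i, j) =
      (\<Sum>g\<in>carrier G. \<Sum>k<m. R g $$ (i, j) * S (inv g) $$ (k, k))"
      unfolding index_mat_sum[OF ij]
    proof (rule sum.cong)
      fix g assume g: "g \<in> carrier G"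
      have "(\<psi> (inv g) \<cdot>\<^sub>m R g) $$ (i, j) = \<psi> (inv g) * R g $$ (i, j)"
        using Rc[OF g] ij by simp
      then show "(\<psi> (inv g) \<cdot>\<^sub>m R g) $$ (i, j) = (\<Sum>k<m. R g $$ (i, j) * S (inv g) $$ (k, k))"
        using g by (simp add: eq rep_character_def mat_trace_carrier[OF Sc] sum_distrib_left mult.commute)
    qed simp
    also have "\<dots> = (\<Sum>k<m. \<Sum>g\<in>carrier G. R g $$ (i, j) * S (inv g) $$ (k, k))"
      by (rule sum.swap)
    also have "\<dots> = (\<Sum>k<m. mat_sum n m (\<lambda>g. R g * ?E m k * S (inv g)) (carrier G) $$ (i, k))"
    proof (rule sum.cong)
      fix k assume "k \<in> {..<m}"
      then have k: "k < m" by simp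
      show "(\<Sum>g\<in>carrier G. R g $$ (i, j) * S (inv g) $$ (k, k)) =
        mat_sum n m (\<lambda>g. R g * ?E m k * S (inv g)) (carrier G) $$ (i, k)"
        unfolding index_mat_sum[OF ij(1) k]
        by (rule sum.cong[OF refl], rule mult_elementary_mult[symmetric]) (use Rc Sc ij k in auto)
    qed simp
    finally show ?thesis .
  qed
  obtain m S where S: "irreducible_rep G m S" and eq: "\<psi> = rep_character G S"
    using \<psi> by (auto simp: irreducible_character_def)
  have "mat_sum n n (\<lambda>g. \<psi> (inv g) \<cdot>\<^sub>m R g) (carrier G) $$ (i, j) =
    (if \<psi> = rep_character G R then of_nat (card (carrier G)) / of_nat n * (if i = j then 1 else 0) else 0)"
  proof (cases "\<psi> = rep_character G R")
    case False
    then have "rep_character G R \<noteq> rep_character G S" by (simp add: eq)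
    from schur_average_zero[OF R S _ this] show ?thesis
      using False ij by (simp add: expand[OF irreducible_rep_hom[OF S] eq])
  next
    case True
    \<comment> \<open>The average is a scalar matrix, so its entry \<open>(i, k)\<close> needs
      \<open>k = i\<close>, and its scalar contains this trace, which needs \<open>k = j\<close>.
      Only \<open>i = j\<close> survives, with one term.\<close>
    have tr: "mat_trace (?E n k) = (if k = j then 1 else 0)" if "k < n" for k
    proof -
      have "mat_trace (?E n k) = (\<Sum>a<n. if a = j then (if k = j then 1 else 0) else 0)"
        by (subst mat_trace_carrier[of _ n]) (auto intro: sum.cong)
      then show ?thesis using ij by simp
    qed
    have "mat_sum n n (\<lambda>g. \<psi> (inv g) \<cdot>\<^sub>m R g) (carrier G) $$ (i, j) =
      (\<Sum>k<n. if k = i then of_nat (card (carrier G)) / of_nat n * (if i = j then 1 else 0) else 0)"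
      unfolding expand[OF irreducible_rep_hom[OF R] True]
      by (rule sum.cong) (use ij in \<open>auto simp: schur_average_scalar[OF R] tr\<close>)
    then show ?thesis using True ij by simp
  qed
  then show "mat_sum n n (\<lambda>g. \<psi> (inv g) \<cdot>\<^sub>m R g) (carrier G) $$ (i, j) =
    ?rhs $$ (i, j)"
    using ij by auto
qed (auto simp: mat_sum_def)

text \<open>The matrix \<open>H = \<Sum>\<^sub>g R(g)\<^sup>* R(g)\<close> is positive definite and satisfies \<open>H R(h) = R(h\<inverse>)\<^sup>* H\<close>.\<close>

lemma rep_character_inv:
  assumes R: "R \<in> hom G (GL_complex n)" and h: "h \<in> carrier G"
  shows "rep_character G R (inv h) = cnj (rep_character G R h)"
proof -
  note Rc = rep_carrier[OF R]
  define A where "A g = Matrix.mat n n (\<lambda>(i, j). cnj (R g $$ (j, i)))" for g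
  have Ac: "A g \<in> carrier_mat n n" for g by (simp add: A_def)
  have A_mult: "A (g \<otimes> h) = A h * A g" if "g \<in> carrier G" "h \<in> carrier G" for g h
  proof (rule eq_matI)
    fix i j assume "i < dim_row (A h * A g)" "j < dim_col (A h * A g)"
    then have ij: "i < n" "j < n" by (auto simp: A_def)
    show "A (g \<otimes> h) $$ (i, j) = (A h * A g) $$ (i, j)"
      using that ij
      by (simp add: A_def rep_mult[OF R] index_mult_mat_sum[OF Rc Rc] index_mult_mat_sum[of _ n n _ n]
          mult.commute del: index_mult_mat)
  qed (auto simp: A_def)
  define H where "H = mat_sum n n (\<lambda>g. A g * R g) (carrier G)"
  have H: "H \<in> carrier_mat n n" by (simp add: H_def)
  have ARc: "A g * R g \<in> carrier_mat n n" if "g \<in> carrier G" for g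
    by (rule mult_carrier_mat[OF Ac Rc[OF that]])
  have AR: "(A g * R g) $$ (i, j) = (\<Sum>l<n. cnj (R g $$ (l, i)) * R g $$ (l, j))"
    if "g \<in> carrier G" "i < n" "j < n" for g i j
    unfolding index_mult_mat_sum[OF Ac Rc[OF that(1)] that(2,3)] using that by (simp add: A_def)
  have comm: "H * R h = A (inv h) * H"
  proof -
    have "A (inv h) * H = mat_sum n n (\<lambda>g. A (inv h) * (A g * R g)) (carrier G)"
      unfolding H_def by (rule mult_mat_sum[OF Ac ARc])
    also have "\<dots> = mat_sum n n (\<lambda>g. A (g \<otimes> inv h) * R (g \<otimes> inv h) * R h) (carrier G)"
    proof (rule mat_sum_cong)
      fix g assume g: "g \<in> carrier G"
      have "R (g \<otimes> inv h) * R h = R g"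
        using g h by (simp add: rep_mult[OF R, symmetric] m_assoc)
      then have "A (g \<otimes> inv h) * R (g \<otimes> inv h) * R h = A (g \<otimes> inv h) * R g"
        using g h by (simp add: assoc_mult_mat[OF Ac Rc Rc])
      also have "\<dots> = A (inv h) * (A g * R g)"
        using g h by (simp add: A_mult assoc_mult_mat[OF Ac Ac Rc])
      finally show "A (inv h) * (A g * R g) = A (g \<otimes> inv h) * R (g \<otimes> inv h) * R h" ..
    qed
    also have "\<dots> = mat_sum n n (\<lambda>g. A g * R g * R h) (carrier G)"
      by (rule mat_sum_reindex[of "\<lambda>g. g \<otimes> inv h"], rule bij_betwI[where g = "\<lambda>g. g \<otimes> h"])
        (use h in \<open>auto simp: m_assoc\<close>)
    also have "\<dots> = H * R h"
      unfolding H_def by (rule mat_sum_mult[OF Rc[OF h] ARc, symmetric])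
    finally show ?thesis by simp
  qed
  have "v = 0\<^sub>v n" if v: "v \<in> carrier_vec n" and Hv: "H *\<^sub>v v = 0\<^sub>v n" for v
  proof -
    \<comment> \<open>\<open>w g l\<close> is coordinate \<open>l\<close> of \<open>R g\<close>
      applied to \<open>v\<close>. Pairing \<open>H\<close> applied to \<open>v\<close> with the
      conjugate of \<open>v\<close> gives the sum of all squares |w g l|^2, and the terms with g = 1
      already force \<open>v\<close> to vanish.\<close>
    define w where "w g l = (\<Sum>j<n. R g $$ (l, j) * v $ j)" for g l
    have cnj_w: "cnj (w g l) = (\<Sum>i<n. cnj (v $ i) * cnj (R g $$ (l, i)))" for g l
      by (simp add: w_def mult.commute)
    have "(\<Sum>j<n. H $$ (i, j) * v $ j) = 0" if i: "i < n" for i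
      using arg_cong[OF Hv, of "\<lambda>u. u $ i"] i H v
      by (simp add: mult_mat_vec_def scalar_prod_def atLeast0LessThan)
    then have "0 = (\<Sum>i<n. cnj (v $ i) * (\<Sum>j<n. H $$ (i, j) * v $ j))" by simp
    also have "\<dots> = (\<Sum>i<n. cnj (v $ i) * (\<Sum>g\<in>carrier G. \<Sum>l<n. cnj (R g $$ (l, i)) * w g l))"
    proof (rule sum.cong[OF refl])
      fix i assume "i \<in> {..<n}"
      then have i: "i < n" by simp
      have "(\<Sum>j<n. H $$ (i, j) * v $ j) = (\<Sum>j<n. \<Sum>g\<in>carrier G. \<Sum>l<n. cnj (R g $$ (l, i)) * (R g $$ (l, j) * v $ j))"
        unfolding H_def using i
        by (intro sum.cong refl)
          (simp add: index_mat_sum AR sum_distrib_right mult.assoc del: index_mult_mat)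
      also have "\<dots> = (\<Sum>g\<in>carrier G. \<Sum>j<n. \<Sum>l<n. cnj (R g $$ (l, i)) * (R g $$ (l, j) * v $ j))"
        by (rule sum.swap)
      also have "\<dots> = (\<Sum>g\<in>carrier G. \<Sum>l<n. cnj (R g $$ (l, i)) * w g l)"
        by (rule sum.cong[OF refl], subst sum.swap) (simp add: w_def sum_distrib_left)
      finally show "cnj (v $ i) * (\<Sum>j<n. H $$ (i, j) * v $ j) = cnj (v $ i) * (\<Sum>g\<in>carrier G. \<Sum>l<n. cnj (R g $$ (l, i)) * w g l)"
        by simp
    qed
    also have "\<dots> = (\<Sum>g\<in>carrier G. \<Sum>i<n. \<Sum>l<n. cnj (v $ i) * (cnj (R g $$ (l, i)) * w g l))"
      by (simp add: sum_distrib_left) (rule sum.swap)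
    also have "\<dots> = (\<Sum>g\<in>carrier G. \<Sum>l<n. cnj (w g l) * w g l)"
      by (rule sum.cong[OF refl], subst sum.swap) (simp add: cnj_w sum_distrib_right mult.assoc)
    also have "\<dots> = of_real (\<Sum>g\<in>carrier G. \<Sum>l<n. (cmod (w g l))\<^sup>2)"
      by (simp add: complex_norm_square[symmetric] mult.commute)
    finally have "(\<Sum>g\<in>carrier G. \<Sum>l<n. (cmod (w g l))\<^sup>2) = 0"
      by (metis of_real_eq_0_iff)
    then have "(\<Sum>l<n. (cmod (w \<one> l))\<^sup>2) = 0"
      by (subst (asm) sum_nonneg_eq_0_iff) (auto intro: sum_nonneg finite_carrier)
    then have "w \<one> l = 0" if "l < n" for l
      using that by (subst (asm) sum_nonneg_eq_0_iff) auto
    moreover have "w \<one> l = v $ l" if "l < n" for l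
    proof -
      have "w \<one> l = (\<Sum>j<n. if j = l then v $ j else 0)"
        unfolding w_def by (rule sum.cong) (use that in \<open>auto simp: rep_one[OF R]\<close>)
      then show ?thesis using that by simp
    qed
    ultimately show ?thesis using v by (intro eq_vecI) auto
  qed
  then have "det H \<noteq> 0" using det_0_iff_vec_prod_zero[OF H] by blast
  then obtain U where U: "U \<in> carrier_mat n n" "U * H = 1\<^sub>m n"
    using det_non_zero_imp_unit[OF H, of "()"] by (auto simp: Units_def ring_mat_simps)
  have HU: "H * U = 1\<^sub>m n" using mat_mult_left_right_inverse[OF U(1) H U(2)] .
  \<comment> \<open>By \<open>comm\<close>, conjugating by \<open>H\<close> turns \<open>R h\<close>
    into the adjoint of \<open>R (inv h)\<close>. Equality of traces follows without passing to a
    unitary form of \<open>R\<close>.\<close>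
  have "mat_trace (R h) = mat_trace (U * (H * R h))"
    using mult_mult_eq[OF U(2,1) H Rc[OF h]] Rc[OF h] by simp
  also have "\<dots> = mat_trace ((A (inv h) * H) * U)"
    unfolding comm by (rule mat_trace_comm[OF U(1) mult_carrier_mat[OF Ac H]])
  also have "\<dots> = mat_trace (A (inv h))"
    using U H Ac[of "inv h"] HU by (simp add: assoc_mult_mat[OF Ac H U(1)])
  also have "\<dots> = cnj (mat_trace (R (inv h)))"
    using h by (subst mat_trace_carrier[OF Ac]) (simp add: mat_trace_carrier[OF Rc] A_def)
  finally show ?thesis using h by (simp add: rep_character_def)
qed

section \<open>Direct sums, Maschke's theorem and complete reducibility\<close>

lemma direct_sum_rep:
  assumes R: "R \<in> hom G (GL_complex n)" and S: "S \<in> hom G (GL_complex m)"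
  obtains T where "T \<in> hom G (GL_complex (n + m))"
    "\<And>g. g \<in> carrier G \<Longrightarrow> rep_character G T g = rep_character G R g + rep_character G S g"
proof
  note Rc = rep_carrier[OF R] and Sc = rep_carrier[OF S]
  define T where "T g = four_block_mat (R g) (0\<^sub>m n m) (0\<^sub>m m n) (S g)" for g
  have Tc: "T g \<in> carrier_mat (n + m) (n + m)" if "g \<in> carrier G" for g
    unfolding T_def using Rc[OF that] Sc[OF that] by auto
  show "T \<in> hom G (GL_complex (n + m))"
  proof (rule hom_GL_complexI[OF Tc])
    show "T \<one> = 1\<^sub>m (n + m)" by (simp add: T_def rep_one[OF R] rep_one[OF S])
    show "T (g \<otimes> h) = T g * T h" if g: "g \<in> carrier G" and h: "h \<in> carrier G" for g h
      unfolding T_def using Rc[OF g] Sc[OF g] Rc[OF h] Sc[OF h] g h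
      by (subst mult_four_block_mat[of _ n n _ m _ m]) (auto simp: rep_mult[OF R] rep_mult[OF S])
  qed
  show "rep_character G T g = rep_character G R g + rep_character G S g" if g: "g \<in> carrier G" for g
  proof -
    have split: "(\<Sum>i<n + m. f i) = (\<Sum>i<n. f i) + (\<Sum>i<m. f (n + i))" for f :: "nat \<Rightarrow> complex"
      by (induction m) (auto simp: add.assoc)
    have "mat_trace (T g) = (\<Sum>i<n. T g $$ (i, i)) + (\<Sum>i<m. T g $$ (n + i, n + i))"
      unfolding mat_trace_carrier[OF Tc[OF g]] by (rule split)
    moreover have "T g $$ (i, i) = R g $$ (i, i)" if "i < n" for i
      using that Rc[OF g] Sc[OF g] by (simp add: T_def)
    moreover have "T g $$ (n + i, n + i) = S g $$ (i, i)" if "i < m" for i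
      using that Rc[OF g] Sc[OF g] by (simp add: T_def)
    ultimately show ?thesis
      using g by (simp add: rep_character_def mat_trace_carrier[OF Rc] mat_trace_carrier[OF Sc])
  qed
qed

text \<open>The linear extension of \<open>R\<close> to the group algebra, evaluated at the element
  with coefficients \<open>c\<close>. It vanishes exactly when \<open>c\<close> is a linear relation
  between the matrices \<open>R g\<close>.\<close>

definition rep_ext :: "nat \<Rightarrow> ('a \<Rightarrow> complex mat) \<Rightarrow> ('a \<Rightarrow> complex) \<Rightarrow> complex mat" where
  "rep_ext n R c = mat_sum n n (\<lambda>g. c g \<cdot>\<^sub>m R g) (carrier G)"

lemma rep_ext_carrier [simp]: "rep_ext n R c \<in> carrier_mat n n"
  by (simp add: rep_ext_def)

text \<open>A \<open>G\<close>-invariant idempotent \<open>P = B Q\<close> carries the representation \<open>Q R B\<close> on its image.\<close>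

lemma subrep_of_idempotent:
  assumes R: "R \<in> hom G (GL_complex n)" and P: "P \<in> carrier_mat n n" and PP: "P * P = P"
    and comm: "\<And>g. g \<in> carrier G \<Longrightarrow> P * R g = R g * P"
  obtains k A where "A \<in> hom G (GL_complex k)" "of_nat k = mat_trace P" "k = 0 \<Longrightarrow> P = 0\<^sub>m n n"
    "\<And>g. g \<in> carrier G \<Longrightarrow> mat_trace (A g) = mat_trace (P * R g)"
    "\<And>c. rep_ext k A c = 0\<^sub>m k k \<longleftrightarrow> P * rep_ext n R c = 0\<^sub>m n n"
proof -
  note Rc = rep_carrier[OF R]
  obtain k B Q where B: "B \<in> carrier_mat n k" and Q: "Q \<in> carrier_mat k n"
    and QB: "Q * B = 1\<^sub>m k" and BQ: "B * Q = P"
    by (rule idempotent_factorization[OF P PP])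
  have PB: "P * B = B"
    unfolding BQ[symmetric] using B Q QB by (simp add: assoc_mult_mat[OF B Q B])
  define A where "A g = Q * (R g * B)" for g
  have RBc: "R g * B \<in> carrier_mat n k" if "g \<in> carrier G" for g
    by (rule mult_carrier_mat[OF Rc[OF that] B])
  have Ac: "A g \<in> carrier_mat k k" if "g \<in> carrier G" for g
    unfolding A_def by (rule mult_carrier_mat[OF Q RBc[OF that]])
  have BA: "B * A g = R g * B" if g: "g \<in> carrier G" for g
  proof -
    have "B * A g = P * (R g * B)"
      unfolding A_def by (rule mult_mult_eq[OF BQ B Q RBc[OF g]])
    also have "\<dots> = R g * P * B"
      by (rule mult_mult_eq[OF comm[OF g] P Rc[OF g] B])
    also have "\<dots> = R g * B"
      by (simp add: assoc_mult_mat[OF Rc[OF g] P B] PB)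
    finally show ?thesis .
  qed
  have A_hom: "A \<in> hom G (GL_complex k)"
  proof (rule hom_GL_complexI[OF Ac])
    show "A \<one> = 1\<^sub>m k" using B by (simp add: A_def rep_one[OF R] QB)
    show "A (g \<otimes> h) = A g * A h" if g: "g \<in> carrier G" and h: "h \<in> carrier G" for g h
    proof -
      have "A g * A h = Q * (R g * B * A h)"
        unfolding A_def[of g] by (rule assoc_mult_mat[OF Q RBc[OF g] Ac[OF h]])
      also have "R g * B * A h = R g * (R h * B)"
        by (simp add: assoc_mult_mat[OF Rc[OF g] B Ac[OF h]] BA[OF h])
      also have "\<dots> = R (g \<otimes> h) * B"
        by (simp add: assoc_mult_mat[OF Rc[OF g] Rc[OF h] B] rep_mult[OF R g h])
      finally show ?thesis by (simp add: A_def)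
    qed
  qed
  have k: "of_nat k = mat_trace P"
    using mat_trace_comm[OF Q B] by (simp add: QB BQ mat_trace_one)
  have zero: "P = 0\<^sub>m n n" if "k = 0"
  proof (rule eq_matI)
    fix i j assume "i < dim_row (0\<^sub>m n n :: complex mat)" "j < dim_col (0\<^sub>m n n :: complex mat)"
    then show "P $$ (i, j) = 0\<^sub>m n n $$ (i, j)"
      using index_mult_mat_sum[OF B Q, of i j] that by (simp add: BQ)
  qed (use P in auto)
  have tr: "mat_trace (A g) = mat_trace (P * R g)" if g: "g \<in> carrier G" for g
  proof -
    have "mat_trace (A g) = mat_trace (R g * B * Q)"
      unfolding A_def by (rule mat_trace_comm[OF Q RBc[OF g]])
    also have "R g * B * Q = R g * P"
      by (simp add: assoc_mult_mat[OF Rc[OF g] B Q] BQ)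
    finally show ?thesis by (simp add: comm[OF g])
  qed
  have cR: "c g \<cdot>\<^sub>m R g \<in> carrier_mat n n" if "g \<in> carrier G" for c g
    using Rc[OF that] by simp
  have cA: "c g \<cdot>\<^sub>m A g \<in> carrier_mat k k" if "g \<in> carrier G" for c g
    using Ac[OF that] by simp
  have ext: "B * rep_ext k A c = rep_ext n R c * B" for c
  proof -
    have "B * rep_ext k A c = mat_sum n k (\<lambda>g. B * (c g \<cdot>\<^sub>m A g)) (carrier G)"
      unfolding rep_ext_def by (rule mult_mat_sum[OF B cA])
    also have "\<dots> = mat_sum n k (\<lambda>g. c g \<cdot>\<^sub>m R g * B) (carrier G)"
      by (rule mat_sum_cong) (simp add: mult_smult_distrib[OF B Ac] mult_smult_assoc_mat[OF Rc B] BA)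
    also have "\<dots> = rep_ext n R c * B"
      unfolding rep_ext_def by (rule mat_sum_mult[OF B cR, symmetric])
    finally show ?thesis .
  qed
  have P_ext: "P * rep_ext n R c = rep_ext n R c * P" for c
  proof -
    have "P * rep_ext n R c = mat_sum n n (\<lambda>g. P * (c g \<cdot>\<^sub>m R g)) (carrier G)"
      unfolding rep_ext_def by (rule mult_mat_sum[OF P cR])
    also have "\<dots> = mat_sum n n (\<lambda>g. c g \<cdot>\<^sub>m R g * P) (carrier G)"
      by (rule mat_sum_cong) (simp add: mult_smult_distrib[OF P Rc] mult_smult_assoc_mat[OF Rc P] comm)
    also have "\<dots> = rep_ext n R c * P"
      unfolding rep_ext_def by (rule mat_sum_mult[OF P cR, symmetric])
    finally show ?thesis .
  qed
  \<comment> \<open>By \<open>ext\<close>, \<open>B\<close> intertwines the two extensions. One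
    direction multiplies by \<open>Q\<close> on the right to recover \<open>P\<close>; the other
    cancels \<open>B\<close> on the left by \<open>QB\<close>.\<close>
  have ext0: "rep_ext k A c = 0\<^sub>m k k \<longleftrightarrow> P * rep_ext n R c = 0\<^sub>m n n" for c
  proof
    assume "rep_ext k A c = 0\<^sub>m k k"
    then have RB: "rep_ext n R c * B = 0\<^sub>m n k" using ext[of c] B by simp
    have "rep_ext n R c * (B * Q) = 0\<^sub>m n k * Q"
      by (rule mult_mult_eq[OF RB rep_ext_carrier B Q])
    then show "P * rep_ext n R c = 0\<^sub>m n n" using Q by (simp add: BQ P_ext)
  next
    assume 0: "P * rep_ext n R c = 0\<^sub>m n n"
    have "rep_ext n R c * (P * B) = 0\<^sub>m n n * B"
      by (rule mult_mult_eq[OF 0[unfolded P_ext] rep_ext_carrier P B])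
    then have "B * rep_ext k A c = 0\<^sub>m n k" using B by (simp add: PB ext)
    moreover have "Q * (B * rep_ext k A c) = 1\<^sub>m k * rep_ext k A c"
      by (rule mult_mult_eq[OF QB Q B rep_ext_carrier])
    ultimately show "rep_ext k A c = 0\<^sub>m k k"
      using Q by (simp add: left_mult_one_mat[OF rep_ext_carrier])
  qed
  show thesis by (rule that[OF A_hom k zero tr ext0])
qed

text \<open>\<open>E\<close> projects onto an invariant subspace along an arbitrary complement. The
  mean of its conjugates over the group has the same image, which is what \<open>P * E = E\<close>
  and \<open>E * P = P\<close> say, and commutes with the group.\<close>

lemma maschke:
  assumes R: "R \<in> hom G (GL_complex n)" and E: "E \<in> carrier_mat n n"
    and EE: "E * E = E" and inv: "\<And>g. g \<in> carrier G \<Longrightarrow> E * (R g * E) = R g * E"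
  obtains P where "P \<in> carrier_mat n n" "P * P = P" "P * E = E" "E * P = P"
    "\<And>g. g \<in> carrier G \<Longrightarrow> P * R g = R g * P"
proof
  note Rc = rep_carrier[OF R]
  define T where "T = mat_sum n n (\<lambda>g. R g * E * R (inv g)) (carrier G)"
  have T: "T \<in> carrier_mat n n" by (simp add: T_def)
  define N where "N = (of_nat (card (carrier G)) :: complex)"
  have N: "N \<noteq> 0" using card_carrier_pos by (simp add: N_def)
  define P where "P = (1 / N) \<cdot>\<^sub>m T"
  have f: "R g * E * R (inv g) \<in> carrier_mat n n" if "g \<in> carrier G" for g
    using Rc[OF that] Rc[of "inv g"] that E by (intro mult_carrier_mat[of _ n n]) auto
  have ET: "E * T = T"
  proof -
    have "E * T = mat_sum n n (\<lambda>g. E * (R g * E * R (inv g))) (carrier G)"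
      unfolding T_def by (rule mult_mat_sum[OF E f])
    also have "\<dots> = T"
      unfolding T_def
    proof (rule mat_sum_cong)
      fix g assume g: "g \<in> carrier G"
      show "E * (R g * E * R (inv g)) = R g * E * R (inv g)"
        by (rule mult_mult_eq[OF inv[OF g] E mult_carrier_mat[OF Rc[OF g] E] Rc[OF inv_closed[OF g]]])
    qed
    finally show ?thesis .
  qed
  have "T * E = mat_sum n n (\<lambda>g. R g * E * R (inv g) * E) (carrier G)"
    unfolding T_def by (rule mat_sum_mult[OF E f])
  \<comment> \<open>\<open>R (inv g)\<close> maps the image of \<open>E\<close> into itself, where
    \<open>E\<close> acts as the identity. Each conjugate therefore fixes that image
    pointwise.\<close>
  also have "\<dots> = mat_sum n n (\<lambda>g. E) (carrier G)"
  proof (rule mat_sum_cong)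
    fix g assume g: "g \<in> carrier G"
    note Rg = Rc[OF g] and Rig = Rc[OF inv_closed[OF g]]
    have "R g * E * R (inv g) * E = R g * E * (R (inv g) * E)"
      by (rule assoc_mult_mat[OF mult_carrier_mat[OF Rg E] Rig E])
    also have "\<dots> = R g * (E * (R (inv g) * E))"
      by (rule assoc_mult_mat[OF Rg E mult_carrier_mat[OF Rig E]])
    also have "\<dots> = R g * (R (inv g) * E)" using g by (simp add: inv)
    also have "\<dots> = E"
      using mult_mult_eq[OF rep_mult_inv[OF R g] Rg Rig E] E by simp
    finally show "R g * E * R (inv g) * E = E" .
  qed
  finally have TE: "T * E = N \<cdot>\<^sub>m E" using mat_sum_const[OF E] by (simp add: N_def)
  show "P \<in> carrier_mat n n" by (simp add: P_def T_def)
  show PE: "P * E = E"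
    using TE N E by (auto simp: P_def mult_smult_assoc_mat[OF T E] intro!: eq_matI)
  show EP: "E * P = P"
    by (simp add: P_def mult_smult_distrib[OF E T] ET)
  show "P * P = P"
    using mult_mult_eq[OF PE \<open>P \<in> carrier_mat n n\<close> E \<open>P \<in> carrier_mat n n\<close>] by (simp add: EP)
  show "P * R g = R g * P" if g: "g \<in> carrier G" for g
    using averaging_intertwines[OF R R E g]
    by (simp add: P_def mult_smult_assoc_mat[OF T Rc[OF g]] mult_smult_distrib[OF Rc[OF g] T] flip: T_def)
qed

text \<open>Coordinates on a proper nonzero invariant subspace \<open>W\<close> give a projection
  onto it, which Maschke's argument makes equivariant without changing its image. As this image is
  \<open>W\<close>, the result is neither zero nor the identity.\<close>

lemma reducible_rep_idempotent:
  assumes R: "R \<in> hom G (GL_complex n)" and "n > 0" and red: "\<not> irreducible_rep G n R"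
  obtains P where "P \<in> carrier_mat n n" "P * P = P" "P \<noteq> 0\<^sub>m n n" "P \<noteq> 1\<^sub>m n"
    "\<And>g. g \<in> carrier G \<Longrightarrow> P * R g = R g * P"
proof -
  note Rc = rep_carrier[OF R]
  obtain W where "submodule class_ring W (module_vec TYPE(complex) n)"
    and inv: "\<And>g w. g \<in> carrier G \<Longrightarrow> w \<in> W \<Longrightarrow> R g *\<^sub>v w \<in> W"
    and ne: "W \<noteq> {0\<^sub>v n}" "W \<noteq> carrier_vec n"
    using assms unfolding irreducible_rep_def by auto
  then have W: "W \<subseteq> carrier_vec n" "0\<^sub>v n \<in> W" "\<And>v w. v \<in> W \<Longrightarrow> w \<in> W \<Longrightarrow> v + w \<in> W"
      "\<And>c v. v \<in> W \<Longrightarrow> c \<cdot>\<^sub>v v \<in> W"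
    unfolding submodule_module_vec_iff by auto
  obtain k B Q where B: "B \<in> carrier_mat n k" and Q: "Q \<in> carrier_mat k n" and QB: "Q * B = 1\<^sub>m k"
    and BW: "\<And>v. v \<in> carrier_vec k \<Longrightarrow> B *\<^sub>v v \<in> W" and WB: "\<And>w. w \<in> W \<Longrightarrow> B *\<^sub>v (Q *\<^sub>v w) = w"
    by (rule subspace_coordinates[OF W]) (assumption | rule that)+
  define E where "E = B * Q"
  have E: "E \<in> carrier_mat n n" unfolding E_def by (rule mult_carrier_mat[OF B Q])
  have E_vec: "E *\<^sub>v v = B *\<^sub>v (Q *\<^sub>v v)" if "v \<in> carrier_vec n" for v
    unfolding E_def by (rule assoc_mult_mat_vec[OF B Q that])
  have EW: "E *\<^sub>v v \<in> W" if "v \<in> carrier_vec n" for v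
    unfolding E_vec[OF that] by (rule BW[OF mult_mat_vec_carrier[OF Q that]])
  have E_id: "E *\<^sub>v w = w" if "w \<in> W" for w
    using WB[OF that] E_vec W(1) that by auto
  have EE: "E * E = E"
  proof (rule mat_eq_vecI[OF mult_carrier_mat[OF E E] E])
    fix v :: "complex Matrix.vec" assume v: "v \<in> carrier_vec n"
    show "E * E *\<^sub>v v = E *\<^sub>v v"
      by (simp add: assoc_mult_mat_vec[OF E E v] E_id EW[OF v])
  qed
  have ERE: "E * (R g * E) = R g * E" if g: "g \<in> carrier G" for g
  proof (rule mat_eq_vecI[of _ n n])
    fix v :: "complex Matrix.vec" assume v: "v \<in> carrier_vec n"
    have "E * (R g * E) *\<^sub>v v = E *\<^sub>v (R g *\<^sub>v (E *\<^sub>v v))"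
      by (simp add: assoc_mult_mat_vec[OF E mult_carrier_mat[OF Rc[OF g] E] v] assoc_mult_mat_vec[OF Rc[OF g] E v])
    also have "\<dots> = R g *\<^sub>v (E *\<^sub>v v)" by (rule E_id[OF inv[OF g EW[OF v]]])
    finally show "E * (R g * E) *\<^sub>v v = R g * E *\<^sub>v v"
      by (simp add: assoc_mult_mat_vec[OF Rc[OF g] E v])
  qed (use E Rc[OF g] in auto)
  obtain P where P: "P \<in> carrier_mat n n" "P * P = P" "P * E = E" "E * P = P"
    "\<And>g. g \<in> carrier G \<Longrightarrow> P * R g = R g * P"
    by (rule maschke[OF R E EE ERE]) (assumption | rule that)+
  have "P \<noteq> 0\<^sub>m n n"
  proof
    assume "P = 0\<^sub>m n n"
    then have "E = 0\<^sub>m n n" using P(3) E by simp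
    moreover have "0\<^sub>m n n *\<^sub>v w = 0\<^sub>v n" if "w \<in> W" for w
      using W(1) that by (intro eq_vecI) auto
    ultimately have "w = 0\<^sub>v n" if "w \<in> W" for w
      using E_id[OF that] that by simp
    then show False using ne(1) W(2) by blast
  qed
  moreover have "P \<noteq> 1\<^sub>m n"
  proof
    assume "P = 1\<^sub>m n"
    then have "E = 1\<^sub>m n" using P(4) E by simp
    then have "v \<in> W" if "v \<in> carrier_vec n" for v
      using EW[OF that] that by simp
    then show False using ne(2) W(1) by blast
  qed
  ultimately show thesis by (rule that[OF P(1,2) _ _ P(5)])
qed

text \<open>Instead of a change of basis to block form, the conclusion keeps the two traces of the
  decomposition that matter later: the character and the relations. A list is used so that
  multiplicities are counted. The induction splits \<open>R\<close> by an equivariant idempotent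
  \<open>P\<close> and its complement \<open>P'\<close>.\<close>

lemma complete_reducibility:
  assumes "R \<in> hom G (GL_complex n)"
  shows "\<exists>L. (\<forall>(k, S)\<in>set L. irreducible_rep G k S) \<and>
    (\<forall>g\<in>carrier G. mat_trace (R g) = (\<Sum>(k, S)\<leftarrow>L. mat_trace (S g))) \<and>
    (\<forall>c. rep_ext n R c = 0\<^sub>m n n \<longleftrightarrow> (\<forall>(k, S)\<in>set L. rep_ext k S c = 0\<^sub>m k k))"
  using assms
proof (induction n arbitrary: R rule: less_induct)
  case (less n)
  note R = less.prems and Rc = rep_carrier[OF less.prems]
  consider "n = 0" | "irreducible_rep G n R" | "n > 0" "\<not> irreducible_rep G n R" by blast
  then show ?case
  proof cases
    case 1
    have "mat_trace (R g) = 0" if "g \<in> carrier G" for g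
      using mat_trace_carrier[OF Rc[OF that]] 1 by simp
    moreover have "rep_ext n R c = 0\<^sub>m n n" for c
      by (rule eq_matI) (auto simp: rep_ext_def mat_sum_def 1)
    ultimately show ?thesis by (intro exI[of _ "[]"]) simp
  next
    case 2
    then show ?thesis by (intro exI[of _ "[(n, R)]"]) simp
  next
    case 3
    then obtain P where P: "P \<in> carrier_mat n n" and PP: "P * P = P" and ne: "P \<noteq> 0\<^sub>m n n" "P \<noteq> 1\<^sub>m n"
      and comm: "\<And>g. g \<in> carrier G \<Longrightarrow> P * R g = R g * P"
      by (rule reducible_rep_idempotent[OF R]) (assumption | rule that)+
    define P' where "P' = 1\<^sub>m n - P"
    have P': "P' \<in> carrier_mat n n" unfolding P'_def by (rule minus_carrier_mat[OF P])
    have P'_mult: "P' * X = X - P * X" if "X \<in> carrier_mat n n" for X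
      using that P by (simp add: P'_def minus_mult_distrib_mat[of _ n n])
    have mult_P': "X * P' = X - X * P" if "X \<in> carrier_mat n n" for X
      using that P by (simp add: P'_def mult_minus_distrib_mat[of _ n n _ n])
    have PP'0: "P * P' = 0\<^sub>m n n"
      using P by (simp add: mult_P' PP)
    have P'P': "P' * P' = P'"
      unfolding P'_mult[OF P'] PP'0 using P' by (intro eq_matI) auto
    have comm': "P' * R g = R g * P'" if "g \<in> carrier G" for g
      by (simp add: P'_mult mult_P' Rc that comm)
    have sum: "P * X + P' * X = X" if "X \<in> carrier_mat n n" for X
      unfolding P'_mult[OF that] using that P by (intro eq_matI) auto
    obtain k A where A: "A \<in> hom G (GL_complex k)" and k: "of_nat k = mat_trace P"
      and k0: "k = 0 \<Longrightarrow> P = 0\<^sub>m n n" and trA: "\<And>g. g \<in> carrier G \<Longrightarrow> mat_trace (A g) = mat_trace (P * R g)"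
      and extA: "\<And>c. rep_ext k A c = 0\<^sub>m k k \<longleftrightarrow> P * rep_ext n R c = 0\<^sub>m n n"
      by (rule subrep_of_idempotent[OF R P PP comm]) (assumption | rule that)+
    obtain k' A' where A': "A' \<in> hom G (GL_complex k')" and k': "of_nat k' = mat_trace P'"
      and k'0: "k' = 0 \<Longrightarrow> P' = 0\<^sub>m n n" and trA': "\<And>g. g \<in> carrier G \<Longrightarrow> mat_trace (A' g) = mat_trace (P' * R g)"
      and extA': "\<And>c. rep_ext k' A' c = 0\<^sub>m k' k' \<longleftrightarrow> P' * rep_ext n R c = 0\<^sub>m n n"
      by (rule subrep_of_idempotent[OF R P' P'P' comm']) (assumption | rule that)+
    \<comment> \<open>The degrees of the two parts are the traces of \<open>P\<close> and
      \<open>P'\<close>, so they add up to \<open>n\<close>. Neither idempotent is zero, hence both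
      degrees drop.\<close>
    have "of_nat (k + k') = mat_trace (P * 1\<^sub>m n + P' * 1\<^sub>m n)"
      using P P' by (simp add: k k' mat_trace_add[of _ n])
    then have "(of_nat (k + k') :: complex) = of_nat n" by (simp only: sum one_carrier_mat mat_trace_one)
    then have n: "k + k' = n" by (metis of_nat_eq_iff)
    have "P' \<noteq> 0\<^sub>m n n" using sum[of "1\<^sub>m n"] P P' ne(2) by auto
    then have "k > 0" "k' > 0" using k0 k'0 ne(1) by auto
    then have lt: "k < n" "k' < n" using n by auto
    obtain L where L: "\<forall>(k, S)\<in>set L. irreducible_rep G k S"
      "\<forall>g\<in>carrier G. mat_trace (A g) = (\<Sum>(k, S)\<leftarrow>L. mat_trace (S g))"
      "\<forall>c. rep_ext k A c = 0\<^sub>m k k \<longleftrightarrow> (\<forall>(k, S)\<in>set L. rep_ext k S c = 0\<^sub>m k k)"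
      using less.IH[OF lt(1) A] by blast
    obtain L' where L': "\<forall>(k, S)\<in>set L'. irreducible_rep G k S"
      "\<forall>g\<in>carrier G. mat_trace (A' g) = (\<Sum>(k, S)\<leftarrow>L'. mat_trace (S g))"
      "\<forall>c. rep_ext k' A' c = 0\<^sub>m k' k' \<longleftrightarrow> (\<forall>(k, S)\<in>set L'. rep_ext k S c = 0\<^sub>m k k)"
      using less.IH[OF lt(2) A'] by blast
    have "mat_trace (R g) = mat_trace (A g) + mat_trace (A' g)" if g: "g \<in> carrier G" for g
    proof -
      have "mat_trace (R g) = mat_trace (P * R g + P' * R g)" by (simp add: sum Rc g)
      also have "\<dots> = mat_trace (P * R g) + mat_trace (P' * R g)"
        by (rule mat_trace_add[OF mult_carrier_mat[OF P Rc[OF g]] mult_carrier_mat[OF P' Rc[OF g]]])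
      finally show ?thesis by (simp add: trA trA' g)
    qed
    moreover have "rep_ext n R c = 0\<^sub>m n n \<longleftrightarrow> rep_ext k A c = 0\<^sub>m k k \<and> rep_ext k' A' c = 0\<^sub>m k' k'" for c
      unfolding extA extA' using P P' sum[of "rep_ext n R c"] by auto
    ultimately show ?thesis
      using L L' by (intro exI[of _ "L @ L'"]) (simp add: ball_Un)
  qed
qed

section \<open>Constituents of a character\<close>

text \<open>Moves a sum against a translated character into a trace of the extended representation,
  where matrix identities for \<open>rep_ext\<close> apply.\<close>

lemma mat_trace_mult_rep_ext:
  assumes S: "S \<in> hom G (GL_complex k)" and a: "a \<in> carrier G"
  shows "mat_trace (S a * rep_ext k S c) = (\<Sum>g\<in>carrier G. c g * rep_character G S (a \<otimes> g))"
proof -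
  note Sc = rep_carrier[OF S]
  have cS: "c g \<cdot>\<^sub>m S g \<in> carrier_mat k k" if "g \<in> carrier G" for g
    using Sc[OF that] by simp
  have eq: "S a * (c g \<cdot>\<^sub>m S g) = c g \<cdot>\<^sub>m S (a \<otimes> g)" if "g \<in> carrier G" for g
    by (simp add: mult_smult_distrib[OF Sc[OF a] Sc[OF that]] rep_mult[OF S a that])
  have "S a * rep_ext k S c = mat_sum k k (\<lambda>g. S a * (c g \<cdot>\<^sub>m S g)) (carrier G)"
    unfolding rep_ext_def by (rule mult_mat_sum[OF Sc[OF a] cS])
  also have "\<dots> = mat_sum k k (\<lambda>g. c g \<cdot>\<^sub>m S (a \<otimes> g)) (carrier G)"
    by (rule mat_sum_cong) (rule eq)
  finally have "mat_trace (S a * rep_ext k S c) = (\<Sum>g\<in>carrier G. mat_trace (c g \<cdot>\<^sub>m S (a \<otimes> g)))"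
    using a Sc by (simp add: mat_trace_mat_sum)
  also have "\<dots> = (\<Sum>g\<in>carrier G. c g * rep_character G S (a \<otimes> g))"
    using a by (intro sum.cong) (simp_all add: mat_trace_smult[OF Sc] rep_character_def)
  finally show ?thesis .
qed

text \<open>The trace of \<open>character_sum_rep\<close>; the trace of the identity cancels the
  degree in the denominator.\<close>

lemma character_inner_product:
  assumes S: "irreducible_rep G k S" and \<psi>: "irreducible_character G \<psi>"
  shows "(\<Sum>g\<in>carrier G. \<psi> (inv g) * mat_trace (S g)) =
    (if \<psi> = rep_character G S then of_nat (card (carrier G)) else 0)"
proof -
  note Sc = rep_carrier[OF irreducible_rep_hom[OF S]]
  have "(\<Sum>g\<in>carrier G. \<psi> (inv g) * mat_trace (S g)) = (\<Sum>g\<in>carrier G. mat_trace (\<psi> (inv g) \<cdot>\<^sub>m S g))"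
    by (simp add: mat_trace_smult[OF Sc])
  also have "\<dots> = mat_trace (mat_sum k k (\<lambda>g. \<psi> (inv g) \<cdot>\<^sub>m S g) (carrier G))"
    by (rule mat_trace_mat_sum[symmetric]) (use Sc in auto)
  also have "\<dots> = (if \<psi> = rep_character G S then of_nat (card (carrier G)) else 0)"
    unfolding character_sum_rep[OF S \<psi>] mat_trace_smult[OF one_carrier_mat] mat_trace_one
    using irreducible_rep_degree_pos[OF S] by simp
  finally show ?thesis .
qed

text \<open>\<open>is_constituent\<close> demands a representation affording the remainder of a
  character. This assembles it from the other irreducible summands, with degree 0 for the empty
  list.\<close>

lemma sum_list_rep:
  assumes "\<forall>(k, S)\<in>set L. S \<in> hom G (GL_complex k)"
  obtains n R where "R \<in> hom G (GL_complex n)"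
    "\<And>g. g \<in> carrier G \<Longrightarrow> rep_character G R g = (\<Sum>(k, S)\<leftarrow>L. mat_trace (S g))"
proof -
  have "\<exists>n R. R \<in> hom G (GL_complex n) \<and>
    (\<forall>g\<in>carrier G. rep_character G R g = (\<Sum>(k, S)\<leftarrow>L. mat_trace (S g)))"
    using assms
  proof (induction L)
    case Nil
    have "(\<lambda>_. 1\<^sub>m 0) \<in> hom G (GL_complex 0)" by (rule hom_GL_complexI) auto
    then show ?case
      by (intro exI[of _ 0] exI[of _ "\<lambda>_. 1\<^sub>m 0"]) (simp add: rep_character_def mat_trace_one)
  next
    case (Cons a L)
    obtain k S where a: "a = (k, S)" by (cases a)
    have S: "S \<in> hom G (GL_complex k)" using Cons.prems a by auto
    obtain n R where R: "R \<in> hom G (GL_complex n)"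
      "\<forall>g\<in>carrier G. rep_character G R g = (\<Sum>(k, S)\<leftarrow>L. mat_trace (S g))"
      using Cons by auto
    obtain T where "T \<in> hom G (GL_complex (k + n))"
      "\<And>g. g \<in> carrier G \<Longrightarrow> rep_character G T g = rep_character G S g + rep_character G R g"
      by (rule direct_sum_rep[OF S R(1)]) (assumption | rule that)+
    then show ?case
      using R(2) a by (intro exI[of _ "k + n"] exI[of _ T]) (simp add: rep_character_def)
  qed
  then show thesis using that by blast
qed

text \<open>The inner product with an irreducible character counts its occurrences in a
  decomposition, so the count depends only on \<phi>. For a constituent, decomposing the remainder
  gives a second list, which contains it. Conversely, an entry of \<open>L\<close> is split off and
  the remaining ones are summed.\<close>

lemma constituents_of_decomposition:
  assumes L: "\<forall>(k, S)\<in>set L. irreducible_rep G k S"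
    and \<phi>: "\<forall>g\<in>carrier G. \<phi> g = (\<Sum>(k, S)\<leftarrow>L. mat_trace (S g))"
  shows "{\<psi>. irreducible_character G \<psi> \<and> is_constituent G \<psi> \<phi>} = (\<lambda>(k, S). rep_character G S) ` set L"
proof (intro equalityI subsetI)
  have inner: "(\<Sum>g\<in>carrier G. \<psi> (inv g) * (\<Sum>(k, S)\<leftarrow>M. mat_trace (S g))) =
      of_nat (card (carrier G)) * of_nat (length (filter (\<lambda>(k, S). \<psi> = rep_character G S) M))"
    if "irreducible_character G \<psi>" "\<forall>(k, S)\<in>set M. irreducible_rep G k S" for \<psi> M
    using that(2)
  proof (induction M)
    case (Cons a M)
    obtain k S where a: "a = (k, S)" by (cases a)
    then have "irreducible_rep G k S" using Cons.prems by auto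
    from character_inner_product[OF this that(1)] show ?case
      using Cons a by (simp add: distrib_left sum.distrib)
  qed simp
  fix \<psi> assume "\<psi> \<in> {\<psi>. irreducible_character G \<psi> \<and> is_constituent G \<psi> \<phi>}"
  then obtain n R where \<psi>: "irreducible_character G \<psi>" and R: "R \<in> hom G (GL_complex n)"
    and eq: "\<forall>g\<in>carrier G. \<phi> g = \<psi> g + rep_character G R g"
    unfolding is_constituent_def by blast
  obtain m T where T: "irreducible_rep G m T" and \<psi>T: "\<psi> = rep_character G T"
    using \<psi> by (auto simp: irreducible_character_def)
  obtain M where M: "\<forall>(k, S)\<in>set M. irreducible_rep G k S"
    "\<forall>g\<in>carrier G. mat_trace (R g) = (\<Sum>(k, S)\<leftarrow>M. mat_trace (S g))"
    using complete_reducibility[OF R] by blast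
  have "(\<Sum>g\<in>carrier G. \<psi> (inv g) * (\<Sum>(k, S)\<leftarrow>L. mat_trace (S g))) =
    (\<Sum>g\<in>carrier G. \<psi> (inv g) * (\<Sum>(k, S)\<leftarrow>(m, T) # M. mat_trace (S g)))"
    by (rule sum.cong) (use eq \<phi> M(2) in \<open>auto simp: \<psi>T rep_character_def\<close>)
  also have "\<dots> = of_nat (card (carrier G)) * of_nat (length (filter (\<lambda>(k, S). \<psi> = rep_character G S) ((m, T) # M)))"
    by (rule inner[OF \<psi>]) (use T M(1) in auto)
  \<comment> \<open>Occurrences are counted by a natural number, so the leading entry
    \<open>(m, T)\<close> cannot be cancelled by \<open>M\<close>.\<close>
  also have "\<dots> \<noteq> 0" using card_carrier_pos by (simp add: \<psi>T del: of_nat_Suc)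
  finally have "filter (\<lambda>(k, S). \<psi> = rep_character G S) L \<noteq> []"
    unfolding inner[OF \<psi> L] by auto
  then show "\<psi> \<in> (\<lambda>(k, S). rep_character G S) ` set L"
    by (force simp: filter_empty_conv)
next
  fix \<psi> assume "\<psi> \<in> (\<lambda>(k, S). rep_character G S) ` set L"
  then obtain k S where S: "(k, S) \<in> set L" and \<psi>: "\<psi> = rep_character G S" by auto
  obtain L1 L2 where split: "L = L1 @ (k, S) # L2" using S by (meson split_list)
  have "\<forall>(k, S)\<in>set (L1 @ L2). S \<in> hom G (GL_complex k)"
    using L split irreducible_rep_hom by fastforce
  then obtain n R where R: "R \<in> hom G (GL_complex n)"
    "\<And>g. g \<in> carrier G \<Longrightarrow> rep_character G R g = (\<Sum>(k, S)\<leftarrow>L1 @ L2. mat_trace (S g))"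
    by (rule sum_list_rep) auto
  have "\<psi> g = mat_trace (S g)" if "g \<in> carrier G" for g
    using that by (simp add: \<psi> rep_character_def)
  then have "is_constituent G \<psi> \<phi>"
    unfolding is_constituent_def
    by (intro exI[of _ n] exI[of _ R] conjI ballI R(1))
      (simp add: R(2) \<phi> split)
  moreover have "irreducible_character G \<psi>"
    using L S \<psi> unfolding irreducible_character_def by blast
  ultimately show "\<psi> \<in> {\<psi>. irreducible_character G \<psi> \<and> is_constituent G \<psi> \<phi>}" by blast
qed

section \<open>From the real representation to its complex constituents\<close>

text \<open>An enumeration \<open>f\<close> of the index type turns \<open>D\<close> into matrices
  with numeric indices. Their entries are real, so a complex relation between them splits into its
  real and imaginary parts.\<close>

lemma complexification:
  fixes D :: "'a \<Rightarrow> real ^ 'd ^ 'd"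
  assumes D: "D \<in> hom G GL_real"
  obtains R where "R \<in> hom G (GL_complex CARD('d))"
    "\<And>g. g \<in> carrier G \<Longrightarrow> mat_trace (R g) = complex_of_real (trace (D g))"
    "\<And>c. rep_ext CARD('d) R c = 0\<^sub>m CARD('d) CARD('d) \<longleftrightarrow>
      (\<Sum>g\<in>carrier G. Re (c g) *\<^sub>R D g) = 0 \<and> (\<Sum>g\<in>carrier G. Im (c g) *\<^sub>R D g) = 0"
proof -
  define d where "d = CARD('d)"
  obtain f :: "nat \<Rightarrow> 'd" where f: "bij_betw f {..<d} UNIV"
    using ex_bij_betw_nat_finite[of "UNIV :: 'd set"] by (auto simp: d_def atLeast0LessThan)
  have sum_f: "(\<Sum>i<d. h (f i)) = sum h UNIV" for h :: "'d \<Rightarrow> complex"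
    by (rule sum.reindex_bij_betw[OF f])
  define R where "R g = Matrix.mat d d (\<lambda>(i, j). complex_of_real (vec_nth (vec_nth (D g) (f i)) (f j)))" for g
  have Rc: "R g \<in> carrier_mat d d" for g by (simp add: R_def)
  have D_mult: "D (g \<otimes> h) = D g ** D h" if "g \<in> carrier G" "h \<in> carrier G" for g h
    using hom_mult[OF D that] by (simp add: GL_real_def)
  have "D \<one> = Finite_Cartesian_Product.mat 1"
  proof -
    have "invertible (D \<one>)" using hom_in_carrier[OF D] by (simp add: GL_real_def)
    then obtain U where U: "U ** D \<one> = Finite_Cartesian_Product.mat 1" by (auto simp: invertible_def)
    have "U ** (D \<one> ** D \<one>) = U ** D \<one>" using D_mult[of \<one> \<one>] by simp
    then show ?thesis by (simp add: matrix_mul_assoc U)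
  qed
  have hom: "R \<in> hom G (GL_complex d)"
  proof (rule hom_GL_complexI[OF Rc])
    have "f i = f j \<longleftrightarrow> i = j" if "i < d" "j < d" for i j
      using f that by (auto simp: bij_betw_def inj_on_def)
    then show "R \<one> = 1\<^sub>m d"
      using \<open>D \<one> = _\<close> by (intro eq_matI) (auto simp: R_def Finite_Cartesian_Product.mat_def)
    show "R (g \<otimes> h) = R g * R h" if "g \<in> carrier G" "h \<in> carrier G" for g h
    proof (rule eq_matI)
      fix i j assume "i < dim_row (R g * R h)" "j < dim_col (R g * R h)"
      then have ij: "i < d" "j < d" by (auto simp: R_def)
      have "R (g \<otimes> h) $$ (i, j) = (\<Sum>k\<in>UNIV. complex_of_real (vec_nth (vec_nth (D g) (f i)) k * vec_nth (vec_nth (D h) k) (f j)))"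
        using ij by (simp add: R_def D_mult[OF that] matrix_matrix_mult_def)
      also have "\<dots> = (\<Sum>l<d. R g $$ (i, l) * R h $$ (l, j))"
        unfolding sum_f[symmetric] by (rule sum.cong) (use ij in \<open>auto simp: R_def\<close>)
      also have "\<dots> = (R g * R h) $$ (i, j)"
        by (rule index_mult_mat_sum[OF Rc Rc ij, symmetric])
      finally show "R (g \<otimes> h) $$ (i, j) = (R g * R h) $$ (i, j)" .
    qed (auto simp: R_def)
  qed
  have tr: "mat_trace (R g) = complex_of_real (trace (D g))" for g
    unfolding mat_trace_carrier[OF Rc] trace_def of_real_sum sum_f[symmetric]
    by (rule sum.cong) (auto simp: R_def)
  have ext: "rep_ext d R c = 0\<^sub>m d d \<longleftrightarrow>
      (\<Sum>g\<in>carrier G. Re (c g) *\<^sub>R D g) = 0 \<and> (\<Sum>g\<in>carrier G. Im (c g) *\<^sub>R D g) = 0" for c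
  proof -
    have entry: "rep_ext d R c $$ (i, j) =
      Complex (vec_nth (vec_nth (\<Sum>g\<in>carrier G. Re (c g) *\<^sub>R D g) (f i)) (f j))
        (vec_nth (vec_nth (\<Sum>g\<in>carrier G. Im (c g) *\<^sub>R D g) (f i)) (f j))" if "i < d" "j < d" for i j
      using that by (simp add: rep_ext_def index_mat_sum R_def complex_eq_iff)
    show ?thesis
    proof
      assume 0: "rep_ext d R c = 0\<^sub>m d d"
      have surj: "\<exists>a<d. f a = x" for x
        using f unfolding bij_betw_def by (metis UNIV_I imageE lessThan_iff)
      have "Complex (vec_nth (vec_nth (\<Sum>g\<in>carrier G. Re (c g) *\<^sub>R D g) x) y)
        (vec_nth (vec_nth (\<Sum>g\<in>carrier G. Im (c g) *\<^sub>R D g) x) y) = 0" for x y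
      proof -
        obtain a b where "a < d" "f a = x" "b < d" "f b = y" using surj by blast
        then show ?thesis using entry[of a b] by (simp only: 0 index_zero_mat)
      qed
      then show "(\<Sum>g\<in>carrier G. Re (c g) *\<^sub>R D g) = 0 \<and> (\<Sum>g\<in>carrier G. Im (c g) *\<^sub>R D g) = 0"
        by (simp add: Finite_Cartesian_Product.vec_eq_iff complex_eq_iff)
    next
      assume "(\<Sum>g\<in>carrier G. Re (c g) *\<^sub>R D g) = 0 \<and> (\<Sum>g\<in>carrier G. Im (c g) *\<^sub>R D g) = 0"
      then show "rep_ext d R c = 0\<^sub>m d d"
        by (intro eq_matI) (simp_all add: entry complex_eq_iff carrier_matD[OF rep_ext_carrier])
    qed
  qed
  show thesis by (rule that[OF hom[unfolded d_def] tr ext[unfolded d_def]])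
qed

text \<open>One and the same list describes both the constituents and the relations, which is what
  links gamma to the relations.\<close>

lemma real_decomposition:
  fixes D :: "'a \<Rightarrow> real ^ 'd ^ 'd"
  assumes D: "D \<in> hom G GL_real"
  obtains L where "\<forall>(k, S)\<in>set L. irreducible_rep G k S"
    "Irr_of G D = (\<lambda>(k, S). rep_character G S) ` set L"
    "\<And>c. (\<Sum>g\<in>carrier G. Re (c g) *\<^sub>R D g) = 0 \<and> (\<Sum>g\<in>carrier G. Im (c g) *\<^sub>R D g) = 0 \<longleftrightarrow>
      (\<forall>(k, S)\<in>set L. rep_ext k S c = 0\<^sub>m k k)"
proof -
  obtain R where R: "R \<in> hom G (GL_complex CARD('d))"
    and tr: "\<And>g. g \<in> carrier G \<Longrightarrow> mat_trace (R g) = complex_of_real (trace (D g))"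
    and ext: "\<And>c. rep_ext CARD('d) R c = 0\<^sub>m CARD('d) CARD('d) \<longleftrightarrow>
      (\<Sum>g\<in>carrier G. Re (c g) *\<^sub>R D g) = 0 \<and> (\<Sum>g\<in>carrier G. Im (c g) *\<^sub>R D g) = 0"
    by (rule complexification[OF D]) (assumption | rule that)+
  obtain L where L: "\<forall>(k, S)\<in>set L. irreducible_rep G k S"
    "\<forall>g\<in>carrier G. mat_trace (R g) = (\<Sum>(k, S)\<leftarrow>L. mat_trace (S g))"
    "\<forall>c. rep_ext CARD('d) R c = 0\<^sub>m CARD('d) CARD('d) \<longleftrightarrow> (\<forall>(k, S)\<in>set L. rep_ext k S c = 0\<^sub>m k k)"
    using complete_reducibility[OF R] by blast
  have "\<forall>g\<in>carrier G. real_rep_character G D g = (\<Sum>(k, S)\<leftarrow>L. mat_trace (S g))"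
    using L(2) tr by (simp add: real_rep_character_def)
  then have "Irr_of G D = (\<lambda>(k, S). rep_character G S) ` set L"
    unfolding Irr_of_def by (rule constituents_of_decomposition[OF L(1)])
  then show thesis by (rule that[OF L(1)]) (use L(3) ext in blast)
qed

section \<open>The function gamma as a projection\<close>

context
  fixes D :: "'a \<Rightarrow> real ^ 'd ^ 'd"
  assumes D: "D \<in> hom G GL_real"
begin

text \<open>Without finiteness the sum defining \<open>gamma_char\<close> would be 0 by
  convention.\<close>

lemma finite_Irr_of: "finite (Irr_of G D)"
  by (rule real_decomposition[OF D]) simp

lemma Irr_of_irreducible_rep:
  assumes "\<psi> \<in> Irr_of G D"
  obtains k S where "irreducible_rep G k S" "\<psi> = rep_character G S"
  using assms by (auto simp: Irr_of_def irreducible_character_def)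

text \<open>The group algebra element with coefficients gamma(h^-1) is |G| times the central
  idempotent of the constituents, so it acts as |G| on each of them. The general \<open>x\<close>
  follows by translating the summation variable.\<close>

lemma rep_ext_gamma:
  assumes S: "irreducible_rep G k S" and Irr: "rep_character G S \<in> Irr_of G D" and x: "x \<in> carrier G"
  shows "rep_ext k S (\<lambda>h. gamma_char G D (inv h \<otimes> x)) = of_nat (card (carrier G)) \<cdot>\<^sub>m S x"
proof -
  define N where "N = (of_nat (card (carrier G)) :: complex)"
  note hom = irreducible_rep_hom[OF S]
  note Sc = rep_carrier[OF hom]
  have one: "rep_ext k S (\<lambda>g. gamma_char G D (inv g)) = N \<cdot>\<^sub>m 1\<^sub>m k"
  proof (rule eq_matI)
    fix i j assume "i < dim_row (N \<cdot>\<^sub>m 1\<^sub>m k)" "j < dim_col (N \<cdot>\<^sub>m 1\<^sub>m k)"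
    then have ij: "i < k" "j < k" by auto
    have smult: "(c \<cdot>\<^sub>m S g) $$ (i, j) = c * S g $$ (i, j)" if "g \<in> carrier G" for c g
      using Sc[OF that] ij by simp
    have "rep_ext k S (\<lambda>g. gamma_char G D (inv g)) $$ (i, j) =
      (\<Sum>g\<in>carrier G. \<Sum>\<psi>\<in>Irr_of G D. \<psi> \<one> * (\<psi> (inv g) \<cdot>\<^sub>m S g) $$ (i, j))"
      unfolding rep_ext_def index_mat_sum[OF ij]
      by (rule sum.cong) (simp_all add: smult gamma_char_def sum_distrib_right mult.assoc)
    also have "\<dots> = (\<Sum>\<psi>\<in>Irr_of G D. \<psi> \<one> * mat_sum k k (\<lambda>g. \<psi> (inv g) \<cdot>\<^sub>m S g) (carrier G) $$ (i, j))"
      unfolding index_mat_sum[OF ij] sum_distrib_left by (rule sum.swap)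
    \<comment> \<open>Orthogonality leaves only the character of \<open>S\<close>. Its weight
      \<psi>(1) = \<open>k\<close> cancels the factor 1/k of \<open>character_sum_rep\<close>, which
      is the reason for the weights in gamma.\<close>
    also have "\<dots> = (\<Sum>\<psi>\<in>Irr_of G D. if \<psi> = rep_character G S then N * 1\<^sub>m k $$ (i, j) else 0)"
    proof (rule sum.cong)
      fix \<psi> assume "\<psi> \<in> Irr_of G D"
      then have "irreducible_character G \<psi>" by (simp add: Irr_of_def)
      from character_sum_rep[OF S this]
      show "\<psi> \<one> * mat_sum k k (\<lambda>g. \<psi> (inv g) \<cdot>\<^sub>m S g) (carrier G) $$ (i, j) =
        (if \<psi> = rep_character G S then N * 1\<^sub>m k $$ (i, j) else 0)"
        using irreducible_rep_degree_pos[OF S] ij by (simp add: rep_character_one[OF hom] N_def)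
    qed simp
    also have "\<dots> = N * 1\<^sub>m k $$ (i, j)"
      using finite_Irr_of Irr by simp
    finally show "rep_ext k S (\<lambda>g. gamma_char G D (inv g)) $$ (i, j) = (N \<cdot>\<^sub>m 1\<^sub>m k) $$ (i, j)"
      using ij by simp
  qed (auto simp: rep_ext_def mat_sum_def)
  have cS: "c g \<cdot>\<^sub>m S g \<in> carrier_mat k k" if "g \<in> carrier G" for c g
    using Sc[OF that] by simp
  have shift: "gamma_char G D (inv (x \<otimes> u) \<otimes> x) \<cdot>\<^sub>m S (x \<otimes> u) = S x * (gamma_char G D (inv u) \<cdot>\<^sub>m S u)"
    if u: "u \<in> carrier G" for u
  proof -
    have "inv (x \<otimes> u) \<otimes> x = inv u" using u x by (simp add: inv_mult_group m_assoc)
    then show ?thesis by (simp add: rep_mult[OF hom x u] mult_smult_distrib[OF Sc[OF x] Sc[OF u]])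
  qed
  have "rep_ext k S (\<lambda>h. gamma_char G D (inv h \<otimes> x)) =
    mat_sum k k (\<lambda>u. gamma_char G D (inv (x \<otimes> u) \<otimes> x) \<cdot>\<^sub>m S (x \<otimes> u)) (carrier G)"
    unfolding rep_ext_def by (rule mat_sum_reindex[OF bij_betw_mult_left[OF x], symmetric])
  also have "\<dots> = mat_sum k k (\<lambda>u. S x * (gamma_char G D (inv u) \<cdot>\<^sub>m S u)) (carrier G)"
    by (rule mat_sum_cong) (rule shift)
  also have "\<dots> = S x * rep_ext k S (\<lambda>g. gamma_char G D (inv g))"
    unfolding rep_ext_def by (rule mult_mat_sum[OF Sc[OF x] cS, symmetric])
  also have "\<dots> = N \<cdot>\<^sub>m S x"
    unfolding one using Sc[OF x] by (simp add: mult_smult_distrib[OF Sc[OF x] one_carrier_mat])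
  finally show ?thesis by (simp add: N_def)
qed

lemma sum_gamma:
  assumes "h \<in> carrier G"
  shows "(\<Sum>g\<in>carrier G. c g * gamma_char G D (h \<otimes> g)) =
    (\<Sum>\<psi>\<in>Irr_of G D. \<psi> \<one> * (\<Sum>g\<in>carrier G. c g * \<psi> (h \<otimes> g)))"
  unfolding gamma_char_def sum_distrib_left
  by (subst sum.swap) (simp add: mult.left_commute)

text \<open>Idempotency of \<open>E\<close>, up to the factor |G|. One gamma is expanded into
  characters, written as traces; \<open>rep_ext_gamma\<close> then absorbs the other.\<close>

lemma gamma_convolution:
  assumes x: "x \<in> carrier G" and y: "y \<in> carrier G"
  shows "(\<Sum>h\<in>carrier G. gamma_char G D (inv x \<otimes> h) * gamma_char G D (inv h \<otimes> y)) =
    of_nat (card (carrier G)) * gamma_char G D (inv x \<otimes> y)"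
proof -
  have "(\<Sum>h\<in>carrier G. gamma_char G D (inv x \<otimes> h) * gamma_char G D (inv h \<otimes> y)) =
    (\<Sum>\<psi>\<in>Irr_of G D. \<psi> \<one> * (\<Sum>h\<in>carrier G. gamma_char G D (inv h \<otimes> y) * \<psi> (inv x \<otimes> h)))"
    using sum_gamma[of "inv x" "\<lambda>h. gamma_char G D (inv h \<otimes> y)"] x by (simp add: mult.commute)
  also have "\<dots> = (\<Sum>\<psi>\<in>Irr_of G D. \<psi> \<one> * (of_nat (card (carrier G)) * \<psi> (inv x \<otimes> y)))"
  proof (rule sum.cong)
    fix \<psi> assume Irr: "\<psi> \<in> Irr_of G D"
    then obtain k S where S: "irreducible_rep G k S" and \<psi>: "\<psi> = rep_character G S"
      by (rule Irr_of_irreducible_rep)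
    note hom = irreducible_rep_hom[OF S]
    note Sc = rep_carrier[OF hom]
    have ix: "inv x \<in> carrier G" using x by simp
    have "(\<Sum>h\<in>carrier G. gamma_char G D (inv h \<otimes> y) * \<psi> (inv x \<otimes> h)) =
      mat_trace (S (inv x) * rep_ext k S (\<lambda>h. gamma_char G D (inv h \<otimes> y)))"
      unfolding \<psi> by (rule mat_trace_mult_rep_ext[OF hom ix, symmetric])
    also have "\<dots> = mat_trace (of_nat (card (carrier G)) \<cdot>\<^sub>m S (inv x \<otimes> y))"
      unfolding rep_ext_gamma[OF S Irr[unfolded \<psi>] y] mult_smult_distrib[OF Sc[OF ix] Sc[OF y]]
      by (simp add: rep_mult[OF hom ix y])
    also have "\<dots> = of_nat (card (carrier G)) * \<psi> (inv x \<otimes> y)"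
      using ix y by (simp add: mat_trace_smult[OF Sc] \<psi> rep_character_def)
    finally show "\<psi> \<one> * (\<Sum>h\<in>carrier G. gamma_char G D (inv h \<otimes> y) * \<psi> (inv x \<otimes> h)) =
      \<psi> \<one> * (of_nat (card (carrier G)) * \<psi> (inv x \<otimes> y))" by simp
  qed simp
  also have "\<dots> = of_nat (card (carrier G)) * gamma_char G D (inv x \<otimes> y)"
    by (simp add: gamma_char_def sum_distrib_left mult.left_commute)
  finally show ?thesis .
qed

text \<open>Hermitian symmetry of \<open>E\<close>: the weights are degrees and hence real.\<close>

lemma gamma_inv:
  assumes g: "g \<in> carrier G"
  shows "gamma_char G D (inv g) = cnj (gamma_char G D g)"
  unfolding gamma_char_def cnj_sum
proof (rule sum.cong)
  fix \<psi> assume "\<psi> \<in> Irr_of G D"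
  then obtain k S where S: "irreducible_rep G k S" and \<psi>: "\<psi> = rep_character G S"
    by (rule Irr_of_irreducible_rep)
  note hom = irreducible_rep_hom[OF S]
  show "\<psi> \<one> * \<psi> (inv g) = cnj (\<psi> \<one> * \<psi> g)"
    by (simp add: \<psi> rep_character_inv[OF hom g] rep_character_one[OF hom])
qed simp

text \<open>Identifies the kernel of \<open>E\<close>. A relation is killed by every irreducible in
  the decomposition, and taking traces after multiplying by \<open>S (inv h)\<close> kills all sums
  against its character. Conversely, \<open>rep_ext_gamma\<close> recovers the extension of each
  \<open>S\<close> from the sums against gamma.\<close>

lemma relation_iff_gamma:
  "(\<Sum>g\<in>carrier G. Re (c g) *\<^sub>R D g) = 0 \<and> (\<Sum>g\<in>carrier G. Im (c g) *\<^sub>R D g) = 0 \<longleftrightarrow>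
    (\<forall>h\<in>carrier G. (\<Sum>g\<in>carrier G. c g * gamma_char G D (inv h \<otimes> g)) = 0)"
proof -
  obtain L where L: "\<forall>(k, S)\<in>set L. irreducible_rep G k S"
    and Irr: "Irr_of G D = (\<lambda>(k, S). rep_character G S) ` set L"
    and rel: "\<And>c. (\<Sum>g\<in>carrier G. Re (c g) *\<^sub>R D g) = 0 \<and> (\<Sum>g\<in>carrier G. Im (c g) *\<^sub>R D g) = 0 \<longleftrightarrow>
      (\<forall>(k, S)\<in>set L. rep_ext k S c = 0\<^sub>m k k)"
    by (rule real_decomposition[OF D]) (assumption | rule that)+
  have "(\<Sum>g\<in>carrier G. c g * gamma_char G D (inv h \<otimes> g)) = 0"
    if h: "h \<in> carrier G" and 0: "\<forall>(k, S)\<in>set L. rep_ext k S c = 0\<^sub>m k k" for h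
  proof -
    have "(\<Sum>g\<in>carrier G. c g * \<psi> (inv h \<otimes> g)) = 0" if \<psi>_Irr: "\<psi> \<in> Irr_of G D" for \<psi>
    proof -
      obtain k S where S: "(k, S) \<in> set L" and \<psi>: "\<psi> = rep_character G S"
        using \<psi>_Irr Irr by auto
      have hom: "S \<in> hom G (GL_complex k)" using L S irreducible_rep_hom by fastforce
      have "rep_ext k S c = 0\<^sub>m k k" using 0 S by auto
      then have "S (inv h) * rep_ext k S c = 0\<^sub>m k k"
        using rep_carrier[OF hom, of "inv h"] h by simp
      then show ?thesis
        using mat_trace_mult_rep_ext[OF hom, of "inv h" c] h by (simp add: \<psi> mat_trace_def)
    qed
    then show ?thesis using h by (simp add: sum_gamma)
  qed
  moreover have "rep_ext k S c = 0\<^sub>m k k"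
    if 0: "\<forall>h\<in>carrier G. (\<Sum>g\<in>carrier G. c g * gamma_char G D (inv h \<otimes> g)) = 0" and "(k, S) \<in> set L" for k S
  proof (rule eq_matI)
    have S: "irreducible_rep G k S" and SI: "rep_character G S \<in> Irr_of G D"
      using that(2) L Irr by force+
    note Sc = rep_carrier[OF irreducible_rep_hom[OF S]]
    fix i j assume "i < dim_row (0\<^sub>m k k :: complex mat)" "j < dim_col (0\<^sub>m k k :: complex mat)"
    then have ij: "i < k" "j < k" by auto
    have smult: "(c \<cdot>\<^sub>m S g) $$ (i, j) = c * S g $$ (i, j)" if "g \<in> carrier G" for c g
      using Sc[OF that] ij by simp
    have entry: "rep_ext k S c $$ (i, j) = (\<Sum>g\<in>carrier G. c g * S g $$ (i, j))" for c
      unfolding rep_ext_def index_mat_sum[OF ij] by (simp add: smult)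
    \<comment> \<open>The vanishing sums are weighted with the matrix coefficients of
      \<open>S\<close>. Interchanging the summations lets gamma reproduce the coefficient at
      \<open>g\<close>, up to the factor |G|.\<close>
    have "0 = (\<Sum>h\<in>carrier G. (\<Sum>g\<in>carrier G. c g * gamma_char G D (inv h \<otimes> g)) * S h $$ (i, j))"
      using 0 by simp
    also have "\<dots> = (\<Sum>g\<in>carrier G. c g * (\<Sum>h\<in>carrier G. gamma_char G D (inv h \<otimes> g) * S h $$ (i, j)))"
      unfolding sum_distrib_right sum_distrib_left by (subst sum.swap) (simp add: mult.assoc)
    also have "\<dots> = (\<Sum>g\<in>carrier G. c g * (of_nat (card (carrier G)) * S g $$ (i, j)))"
      by (rule sum.cong) (simp_all add: entry[symmetric] rep_ext_gamma[OF S SI] smult)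
    also have "\<dots> = of_nat (card (carrier G)) * rep_ext k S c $$ (i, j)"
      by (simp add: entry sum_distrib_left mult.left_commute)
    finally show "rep_ext k S c $$ (i, j) = 0\<^sub>m k k $$ (i, j)"
      using card_carrier_pos ij by simp
  qed (auto simp: rep_ext_def mat_sum_def)
  ultimately show ?thesis unfolding rel by blast
qed

end

end

section \<open>Affine symmetries\<close>

text \<open>Prescribe the map on a basis chosen among the vectors \<open>v i\<close>. The
  hypothesis, applied to the expansion of any other \<open>v i\<close> in this basis, forces the
  right value there.\<close>

lemma linear_map_of_relations:
  fixes v :: "'i \<Rightarrow> 'v::euclidean_space" and w :: "'i \<Rightarrow> 'w::real_vector"
  assumes I: "finite I"
    and rel: "\<And>c. (\<Sum>i\<in>I. c i *\<^sub>R v i) = 0 \<Longrightarrow> (\<Sum>i\<in>I. c i *\<^sub>R w i) = 0"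
  obtains f where "linear f" "\<And>i. i \<in> I \<Longrightarrow> f (v i) = w i"
proof -
  obtain B where B: "B \<subseteq> v ` I" "independent B" "v ` I \<subseteq> span B"
    using maximal_independent_subset by blast
  have finB: "finite B" using B(1) I by (meson finite_imageI finite_subset)
  define \<sigma> where "\<sigma> = inv_into I v"
  have \<sigma>: "\<sigma> b \<in> I" "v (\<sigma> b) = b" if "b \<in> B" for b
    using B(1) that by (auto simp: \<sigma>_def intro: inv_into_into f_inv_into_f)
  obtain f where f: "linear f" "\<forall>b\<in>B. f b = w (\<sigma> b)"
    using linear_independent_extend[OF B(2), of "\<lambda>b. w (\<sigma> b)"] by blast
  have "f (v i) = w i" if i: "i \<in> I" for i
  proof -
    have "v i \<in> span B" using B(3) i by blast
    then obtain u where u: "v i = (\<Sum>b\<in>B. u b *\<^sub>R b)"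
      unfolding span_finite[OF finB] by auto
    \<comment> \<open>Coefficients of the relation "\<open>v i\<close> minus its basis expansion",
      transported to the index set by the chosen indices \<sigma>. The index \<open>i\<close> may
      itself be one of these, hence the two separate terms.\<close>
    define c where "c j = (if j = i then 1 else 0) - (\<Sum>b\<in>B. if \<sigma> b = j then u b else 0)" for j
    have expand: "(\<Sum>j\<in>I. c j *\<^sub>R h j) = h i - (\<Sum>b\<in>B. u b *\<^sub>R h (\<sigma> b))" for h :: "'i \<Rightarrow> 'x::real_vector"
    proof -
      have "(\<Sum>j\<in>I. c j *\<^sub>R h j) = (\<Sum>j\<in>I. if j = i then h j else 0) - (\<Sum>j\<in>I. \<Sum>b\<in>B. if \<sigma> b = j then u b *\<^sub>R h j else 0)"
        unfolding sum_subtractf[symmetric] c_def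
        by (intro sum.cong refl) (auto simp: scaleR_diff_left scaleR_sum_left intro!: sum.cong)
      also have "(\<Sum>j\<in>I. \<Sum>b\<in>B. if \<sigma> b = j then u b *\<^sub>R h j else 0) = (\<Sum>b\<in>B. u b *\<^sub>R h (\<sigma> b))"
        by (subst sum.swap) (intro sum.cong refl, simp add: I \<sigma>)
      also have "(\<Sum>j\<in>I. if j = i then h j else 0) = h i" using I i by simp
      finally show ?thesis .
    qed
    have "(\<Sum>b\<in>B. u b *\<^sub>R v (\<sigma> b)) = v i" unfolding u by (intro sum.cong refl) (simp add: \<sigma>)
    then have "(\<Sum>j\<in>I. c j *\<^sub>R v j) = 0" by (simp add: expand)
    then have "w i = (\<Sum>b\<in>B. u b *\<^sub>R w (\<sigma> b))" using rel[of c] by (simp add: expand)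
    also have "\<dots> = (\<Sum>b\<in>B. u b *\<^sub>R f b)" using f(2) by simp
    also have "\<dots> = f (v i)" unfolding u by (simp add: linear_sum[OF f(1)] linear_scale[OF f(1)])
    finally show ?thesis ..
  qed
  with f(1) show thesis by (rule that)
qed

context finite_group
begin

section \<open>The two implications for a fixed permutation\<close>

context
  fixes D :: "'a \<Rightarrow> real ^ 'd ^ 'd" and \<pi> :: "'a \<Rightarrow> 'a"
  assumes D: "D \<in> hom G GL_real" and \<pi>: "bij_betw \<pi> (carrier G) (carrier G)"
begin

text \<open>Reindexing by \<pi> reduces this to \<open>relation_iff_gamma\<close> for
  \<open>c\<close> composed with the inverse of \<pi>; the quantified \<open>h\<close> is replaced
  by its image as well.\<close>

lemma permuted_relation_iff_gamma:
  "(\<Sum>g\<in>carrier G. Re (c g) *\<^sub>R D (\<pi> g)) = 0 \<and> (\<Sum>g\<in>carrier G. Im (c g) *\<^sub>R D (\<pi> g)) = 0 \<longleftrightarrow>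
    (\<forall>h\<in>carrier G. (\<Sum>g\<in>carrier G. c g * gamma_char G D (inv (\<pi> h) \<otimes> \<pi> g)) = 0)"
proof -
  define c' where "c' = c \<circ> inv_into (carrier G) \<pi>"
  have c': "c' (\<pi> g) = c g" if "g \<in> carrier G" for g
    using \<pi> that by (simp add: c'_def bij_betw_def)
  have shift: "(\<Sum>g\<in>carrier G. F (c g) (\<pi> g)) = (\<Sum>g\<in>carrier G. F (c' g) g)"
    for F :: "complex \<Rightarrow> 'a \<Rightarrow> 'x::comm_monoid_add"
    using sum.reindex_bij_betw[OF \<pi>, of "\<lambda>g. F (c' g) g"] by (simp add: c')
  have "(\<forall>h\<in>carrier G. (\<Sum>g\<in>carrier G. c g * gamma_char G D (inv (\<pi> h) \<otimes> \<pi> g)) = 0) \<longleftrightarrow>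
      (\<forall>h\<in>\<pi> ` carrier G. (\<Sum>g\<in>carrier G. c' g * gamma_char G D (inv h \<otimes> g)) = 0)"
    by (simp add: shift[of "\<lambda>x g. x * gamma_char G D (inv (\<pi> h) \<otimes> g)" for h])
  also have "\<pi> ` carrier G = carrier G" using \<pi> by (simp add: bij_betw_def)
  finally show ?thesis
    unfolding shift[of "\<lambda>x g. Re x *\<^sub>R D g"] shift[of "\<lambda>x g. Im x *\<^sub>R D g"] relation_iff_gamma[OF D]
    by simp
qed

text \<open>If \<open>\<Sum> D(g) \<noteq> 0\<close>, multiplying a relation by this sum shows that its coefficients sum to \<open>0\<close>,
  and otherwise the symmetry fixes the barycenter \<open>0\<close>; in both cases its translation part drops out.\<close>

lemma affine_symmetry_relation:
  assumes f: "affine_symmetry (rep_polytope G D) f" "\<forall>g\<in>carrier G. f (D g) = D (\<pi> g)"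
    and 0: "(\<Sum>g\<in>carrier G. c g *\<^sub>R D g) = 0"
  shows "(\<Sum>g\<in>carrier G. c g *\<^sub>R D (\<pi> g)) = 0"
proof -
  obtain L b where L: "linear L" and Lb: "\<forall>x\<in>rep_polytope G D. f x = L x + b"
    using f(1) unfolding affine_symmetry_def by blast
  have D\<pi>: "D (\<pi> g) = L (D g) + b" if "g \<in> carrier G" for g
  proof -
    have "D g \<in> rep_polytope G D" using that by (simp add: rep_polytope_def hull_inc)
    then show ?thesis using Lb f(2) that by auto
  qed
  have expand: "(\<Sum>g\<in>carrier G. c g *\<^sub>R D (\<pi> g)) = L (\<Sum>g\<in>carrier G. c g *\<^sub>R D g) + (\<Sum>g\<in>carrier G. c g) *\<^sub>R b" for c
    by (simp add: D\<pi> scaleR_add_right sum.distrib linear_sum[OF L] linear_scale[OF L] scaleR_sum_left)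
  define S where "S = (\<Sum>g\<in>carrier G. D g)"
  have "(\<Sum>g\<in>carrier G. c g) *\<^sub>R b = 0"
  proof (cases "S = 0")
    case True
    have "(\<Sum>g\<in>carrier G. D (\<pi> g)) = S"
      unfolding S_def by (rule sum.reindex_bij_betw[OF \<pi>])
    \<comment> \<open>With all coefficients equal to 1, both sums of matrices are
      \<open>S = 0\<close>, so only |G| times \<open>b\<close> remains.\<close>
    then have "real (card (carrier G)) *\<^sub>R b = 0"
      using expand[of "\<lambda>_. 1"] True by (simp add: S_def linear_0[OF L])
    then show ?thesis using card_carrier_pos by simp
  next
    case False
    have lin: "linear (\<lambda>X :: real ^ 'd ^ 'd. X ** D h)" for h
      by (rule linearI) (simp_all add: matrix_matrix_mult_def Finite_Cartesian_Product.vec_eq_iff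
          sum.distrib distrib_right sum_distrib_left mult.assoc)
    have "(\<Sum>g\<in>carrier G. c g *\<^sub>R D (g \<otimes> h)) = 0" if h: "h \<in> carrier G" for h
    proof -
      have "(\<Sum>g\<in>carrier G. c g *\<^sub>R D (g \<otimes> h)) = (\<Sum>g\<in>carrier G. c g *\<^sub>R D g) ** D h"
        unfolding linear_sum[OF lin] linear_scale[OF lin]
        using hom_mult[OF D _ h] by (intro sum.cong) (simp_all add: GL_real_def)
      then show ?thesis using linear_0[OF lin] by (simp add: 0)
    qed
    then have "0 = (\<Sum>h\<in>carrier G. \<Sum>g\<in>carrier G. c g *\<^sub>R D (g \<otimes> h))" by simp
    also have "\<dots> = (\<Sum>g\<in>carrier G. c g *\<^sub>R (\<Sum>h\<in>carrier G. D (g \<otimes> h)))"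
      by (subst sum.swap) (simp add: scaleR_sum_right)
    also have "\<dots> = (\<Sum>g\<in>carrier G. c g *\<^sub>R S)"
      by (intro sum.cong refl arg_cong2[of _ _ _ _ scaleR])
        (simp add: S_def sum.reindex_bij_betw[OF bij_betw_mult_left])
    finally show ?thesis using False by (simp flip: scaleR_sum_left)
  qed
  then show ?thesis using expand[of c] 0 by (simp add: linear_0[OF L])
qed

text \<open>With \<open>E(g,h) = \<gamma>(g\<inverse>h)\<close>, the matrix \<open>E / |G|\<close> is the orthogonal projection whose kernel is the
  space of relations. If \<open>\<pi>\<close> preserves relations, the permuted matrix \<open>E'\<close> satisfies
  \<open>E' E = |G| E'\<close>, so \<open>E - E'\<close> is a multiple of an orthogonal projection; it vanishes because its
  diagonal does.\<close>

lemma gamma_eq_of_relations: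
  assumes rel: "\<And>c. (\<Sum>g\<in>carrier G. c g *\<^sub>R D g) = 0 \<Longrightarrow> (\<Sum>g\<in>carrier G. c g *\<^sub>R D (\<pi> g)) = 0"
    and k: "k \<in> carrier G" and h: "h \<in> carrier G"
  shows "gamma_char G D (inv (\<pi> k) \<otimes> \<pi> h) = gamma_char G D (inv k \<otimes> h)"
proof -
  define N where "N = (of_nat (card (carrier G)) :: complex)"
  define E where "E g h = gamma_char G D (inv g \<otimes> h)" for g h
  define E' where "E' g h = E (\<pi> g) (\<pi> h)" for g h
  have \<pi>c: "\<pi> g \<in> carrier G" if "g \<in> carrier G" for g using \<pi> that by (auto simp: bij_betw_def)
  have EE: "(\<Sum>g\<in>carrier G. E x g * E g y) = N * E x y" if "x \<in> carrier G" "y \<in> carrier G" for x y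
    using gamma_convolution[OF D that] by (simp add: E_def N_def)
  have E'E': "(\<Sum>g\<in>carrier G. E' x g * E' g y) = N * E' x y" if "x \<in> carrier G" "y \<in> carrier G" for x y
    using EE[OF \<pi>c \<pi>c] that sum.reindex_bij_betw[OF \<pi>, of "\<lambda>g. E (\<pi> x) g * E g (\<pi> y)"] by (simp add: E'_def)
  have cnj_E: "cnj (E x y) = E y x" if "x \<in> carrier G" "y \<in> carrier G" for x y
    using gamma_inv[OF D, of "inv x \<otimes> y"] that by (simp add: E_def inv_mult_group)
  have cnj_E': "cnj (E' x y) = E' y x" if "x \<in> carrier G" "y \<in> carrier G" for x y
    using cnj_E[OF \<pi>c \<pi>c] that by (simp add: E'_def)
  have E'E: "(\<Sum>g\<in>carrier G. E' x g * E g y) = N * E' x y" if x: "x \<in> carrier G" and y: "y \<in> carrier G" for x y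
  proof -
    \<comment> \<open>Column \<open>y\<close> of |G| times the identity minus \<open>E\<close>.
      Idempotency puts it in the kernel of \<open>E\<close>, so its real and imaginary parts are
      relations; \<open>rel\<close> makes the permuted matrix kill it too, which is the
      claim.\<close>
    define c where "c g = (if g = y then N else 0) - E g y" for g
    have delta: "(\<Sum>g\<in>carrier G. c g * F g) = N * F y - (\<Sum>g\<in>carrier G. F g * E g y)" for F
    proof -
      have "c g * F g = (if g = y then N * F y else 0) - F g * E g y" for g
        by (simp add: c_def algebra_simps)
      then show ?thesis using finite_carrier y by (simp add: sum_subtractf)
    qed
    have "\<forall>z\<in>carrier G. (\<Sum>g\<in>carrier G. c g * gamma_char G D (inv z \<otimes> g)) = 0"
      using EE y by (simp add: delta flip: E_def)
    then have "(\<Sum>g\<in>carrier G. Re (c g) *\<^sub>R D g) = 0" "(\<Sum>g\<in>carrier G. Im (c g) *\<^sub>R D g) = 0"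
      unfolding relation_iff_gamma[OF D, symmetric] by auto
    then have "\<forall>z\<in>carrier G. (\<Sum>g\<in>carrier G. c g * gamma_char G D (inv (\<pi> z) \<otimes> \<pi> g)) = 0"
      unfolding permuted_relation_iff_gamma[symmetric] by (simp add: rel)
    then show ?thesis using x by (simp add: delta E'_def flip: E_def)
  qed
  \<comment> \<open>The adjoint of \<open>E'E\<close>, both matrices being Hermitian.\<close>
  have EE': "(\<Sum>g\<in>carrier G. E x g * E' g y) = N * E' x y" if x: "x \<in> carrier G" and y: "y \<in> carrier G" for x y
  proof -
    have "(\<Sum>g\<in>carrier G. E x g * E' g y) = cnj (\<Sum>g\<in>carrier G. E' y g * E g x)"
      unfolding cnj_sum by (intro sum.cong) (simp_all add: cnj_E cnj_E' x y mult.commute)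
    also have "\<dots> = N * E' x y"
      unfolding E'E[OF y x] by (simp add: cnj_E' x y N_def)
    finally show ?thesis .
  qed
  define Z where "Z x y = E x y - E' x y" for x y
  \<comment> \<open>The four products combine to Z^2 = |G| Z. Both diagonal entries at
    \<open>k\<close> are gamma(1), and since \<open>Z\<close> is Hermitian the diagonal entry of Z^2
    is the squared norm of row \<open>k\<close>.\<close>
  have "(\<Sum>g\<in>carrier G. Z k g * Z g k) = N * E k k - N * E' k k"
    unfolding Z_def using EE[OF k k] E'E[OF k k] EE'[OF k k] E'E'[OF k k]
    by (simp add: left_diff_distrib right_diff_distrib sum_subtractf)
  also have "\<dots> = 0" using k \<pi>c by (simp add: E_def E'_def)
  also have "(\<Sum>g\<in>carrier G. Z k g * Z g k) = of_real (\<Sum>g\<in>carrier G. (cmod (Z k g))\<^sup>2)"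
    unfolding of_real_sum
  proof (rule sum.cong)
    fix g assume g: "g \<in> carrier G"
    have "Z g k = cnj (Z k g)" using g k by (simp add: Z_def cnj_E cnj_E')
    then show "Z k g * Z g k = of_real ((cmod (Z k g))\<^sup>2)"
      by (simp only: complex_norm_square)
  qed simp
  finally have "(\<Sum>g\<in>carrier G. (cmod (Z k g))\<^sup>2) = 0" by (simp only: of_real_eq_0_iff)
  then have "Z k h = 0"
    using h by (subst (asm) sum_nonneg_eq_0_iff) (auto simp: finite_carrier)
  then show ?thesis by (simp add: Z_def E_def E'_def)
qed

text \<open>Equal kernels mean that \<pi> preserves and reflects relations, so there are linear maps
  in both directions. \<open>f\<close> may be singular on the whole matrix space; \<open>f'\<close>
  inverts it on the span of the \<open>D g\<close>, which contains the polytope. The symmetry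
  obtained has no translation part.\<close>

lemma affine_symmetry_of_gamma_eq:
  assumes eq: "\<And>g h. g \<in> carrier G \<Longrightarrow> h \<in> carrier G \<Longrightarrow>
    gamma_char G D (inv (\<pi> g) \<otimes> \<pi> h) = gamma_char G D (inv g \<otimes> h)"
  obtains f where "affine_symmetry (rep_polytope G D) f" "\<And>g. g \<in> carrier G \<Longrightarrow> f (D g) = D (\<pi> g)"
proof -
  \<comment> \<open>Real coefficients are read as complex ones, so the imaginary half of each pair
    of relations is trivial.\<close>
  have rel: "(\<Sum>g\<in>carrier G. c g *\<^sub>R D (\<pi> g)) = 0 \<longleftrightarrow> (\<Sum>g\<in>carrier G. c g *\<^sub>R D g) = 0" for c :: "'a \<Rightarrow> real"
    using relation_iff_gamma[OF D, of "\<lambda>g. of_real (c g)"]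
      permuted_relation_iff_gamma[of "\<lambda>g. of_real (c g)"] by (simp add: eq)
  obtain f where f: "linear f" "\<And>g. g \<in> carrier G \<Longrightarrow> f (D g) = D (\<pi> g)"
    by (rule linear_map_of_relations[OF finite_carrier, of D "\<lambda>g. D (\<pi> g)"]) (auto simp: rel)
  obtain f' where f': "linear f'" "\<And>g. g \<in> carrier G \<Longrightarrow> f' (D (\<pi> g)) = D g"
    by (rule linear_map_of_relations[OF finite_carrier, of "\<lambda>g. D (\<pi> g)" D]) (auto simp: rel)
  have "f ` D ` carrier G = D ` \<pi> ` carrier G"
    unfolding image_image by (rule image_cong) (simp_all add: f)
  then have "f ` rep_polytope G D = rep_polytope G D"
    using \<pi> unfolding rep_polytope_def convex_hull_linear_image[OF f(1)] by (simp add: bij_betw_def)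
  moreover have "f' (f x) = x" if "x \<in> rep_polytope G D" for x
  proof (rule linear_eq_on_span[where f = "\<lambda>x. f' (f x)" and g = "\<lambda>x. x" and B = "D ` carrier G"])
    show "linear (\<lambda>x. f' (f x))" using linear_compose[OF f(1) f'(1)] by (simp add: o_def)
    show "x \<in> span (D ` carrier G)"
      using that convex_hull_subset_span unfolding rep_polytope_def by blast
  qed (auto simp: f f' module_hom_ident)
  then have "inj_on f (rep_polytope G D)" by (rule inj_on_inverseI)
  ultimately have "affine_symmetry (rep_polytope G D) f"
    unfolding affine_symmetry_def bij_betw_def using f(1) by (intro conjI exI[of _ f] exI[of _ 0]) auto
  then show thesis using f(2) by (rule that)
qed

end

end

theorem theorem4:
  fixes G :: "('g, 'b) monoid_scheme" (structure)
    and D :: "'g \<Rightarrow> real ^ 'd ^ 'd"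
    and \<pi> :: "'g \<Rightarrow> 'g"
  assumes "group G"
    and "finite (carrier G)"
    and "D \<in> hom G GL_real"
    and "bij_betw \<pi> (carrier G) (carrier G)"
  shows "(\<exists>f. affine_symmetry (rep_polytope G D) f \<and>
              (\<forall>g\<in>carrier G. f (D g) = D (\<pi> g)))
         \<longleftrightarrow>
         (\<forall>g\<in>carrier G. \<forall>h\<in>carrier G.
            gamma_char G D (inv (\<pi> g) \<otimes> \<pi> h) = gamma_char G D (inv g \<otimes> h))"
proof -
  interpret finite_group G
    using assms by (simp add: finite_group_def finite_group_axioms_def)
  show ?thesis
  proof (intro iffI ballI)
    fix g h assume "g \<in> carrier G" "h \<in> carrier G"
      and "\<exists>f. affine_symmetry (rep_polytope G D) f \<and> (\<forall>g\<in>carrier G. f (D g) = D (\<pi> g))"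
    then show "gamma_char G D (inv (\<pi> g) \<otimes> \<pi> h) = gamma_char G D (inv g \<otimes> h)"
      using gamma_eq_of_relations[OF assms(3,4)] affine_symmetry_relation[OF assms(3,4)] by blast
  next
    assume "\<forall>g\<in>carrier G. \<forall>h\<in>carrier G. gamma_char G D (inv (\<pi> g) \<otimes> \<pi> h) = gamma_char G D (inv g \<otimes> h)"
    then obtain f where "affine_symmetry (rep_polytope G D) f" "\<And>g. g \<in> carrier G \<Longrightarrow> f (D g) = D (\<pi> g)"
      using affine_symmetry_of_gamma_eq[OF assms(3,4)] by blast
    then show "\<exists>f. affine_symmetry (rep_polytope G D) f \<and> (\<forall>g\<in>carrier G. f (D g) = D (\<pi> g))"
      by blast
  qed
qed

end
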